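(* Let $\mathbf A=(A;\cdot,\backslash,/,1)$ be a non-trivial basic pseudo hoop (i.e. $A\ne\{1\}$), let $I,J$ be sets with $|J|\le|I|$, let $\lambda,\rho:J\to I$ be injections, and let $K_{I,J}^{\lambda,\rho}(\mathbf A)$ be the corresponding kite. The following are equivalent: (1) $\mathbf A$ is subdirectly irreducible and for all $i,j\in I$ there exists an integer $m\ge 0$ such that $(\rho\circ\lambda^{-1})^m(i)=j$ or $(\lambda\circ\rho^{-1})^m(i)=j$. (2) $K_{I,J}^{\lambda,\rho}(\mathbf A)$ is a subdirectly irreducible pseudo BL-algebra.
   Context: PSEUDO HOOPS. A pseudo hoop is an algebra $\mathbf A=(A;\cdot,\backslash,/,1)$ of type $\langle 2,2,2,0\rangle$ such that for all $a,b,c\in A$: (i) $a\cdot 1=1\cdot a=a$; (ii) $a\backslash a=1=a/a$; (iii) $c/(a\cdot b)=(c/b)/a$; (iv) $(a\cdot b)\backslash c=b\backslash(a\backslash c)$; (v) $(b/a)\cdot a=(a/b)\cdot b=a\cdot(a\backslash b)=b\cdot(b\backslash a)$. We write $ab$ for $a\cdot b$; $\cdot$ binds stronger than $\backslash,/$, which bind stronger than $\wedge,\vee$. The order is $a\le b$ iff $a\backslash b=1$ (iff $b/a=1$); $1$ is the top element, and $(A;\cdot,1)$ is a residuated monoid: $xy\le z$ iff $y\le x\backslash z$ iff $x\le z/y$. A pseudo hoop is basic if for all $a,b,c$: $c/(b/a)\le c/(c/(a/b))$ and $(a\backslash b)\backslash c\le((b\backslash a)\backslash c)\backslash c$. A basic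 pseudo hoop is a (distributive) lattice under $\le$. KITES. Let $\overline A=\{\bar a: a\in A\}$ be a disjoint copy of $A$ ($\bar a=\bar b$ iff $a=b$). The kite $K_{I,J}^{\lambda,\rho}(\mathbf A)=((\overline A)^J\uplus A^I;\cdot,\backslash,/,\wedge,\vee,0,1)$ has as universe the disjoint union $(\overline A)^J\uplus A^I$. Order: $A^I$ is ordered coordinatewise; $\langle\bar f_j:j\in J\rangle\le\langle\bar g_j:j\in J\rangle$ iff $g_j\le f_j$ for all $j\in J$; and $x\le y$ for all $x\in(\overline A)^J$, $y\in A^I$. This is a bounded lattice with bottom $0=\langle\bar 1:j\in J\rangle$ and top $1=\langle 1:i\in I\rangle$; $\wedge,\vee$ are its lattice operations. Multiplication: $\langle a_i\rangle\cdot\langle b_i\rangle=\langle a_ib_i\rangle$; $\langle a_i\rangle\cdot\langle\bar f_j\rangle=\langle\overline{f_j/a_{\lambda(j)}}\rangle$; $\langle\bar f_j\rangle\cdot\langle a_i\rangle=\langle\overline{a_{\rho(j)}\backslash f_j}\rangle$; $\langle\bar f_j\rangle\cdot\langle\bar g_j\rangle=0$. Divisions: $\langle a_i\rangle\backslash\langle b_i\rangle=\langle a_i\backslash b_i\rangle$; $\langle b_i\rangle/\langle a_i\rangle=\langle b_i/a_i\rangle$; $\langle a_i\rangle\backslash\langle\bar f_j\rangle=\langle\overline{f_ja_{\lambda(j)}}\rangle$; $\langle\bar f_j\rangle/\langle a_i\rangle=\langle\overline{a_{\rho(j)}f_j}\rangle$; $\langle\bar f_j\rangle\backslash\langle\bar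 g_j\rangle=\langle a_i\rangle$ with $a_i=f_{\rho^{-1}(i)}/g_{\rho^{-1}(i)}$ if $i\in\rho(J)$ and $a_i=1$ otherwise; $\langle\bar g_j\rangle/\langle\bar f_j\rangle=\langle b_i\rangle$ with $b_i=g_{\lambda^{-1}(i)}\backslash f_{\lambda^{-1}(i)}$ if $i\in\lambda(J)$ and $b_i=1$ otherwise; $\langle a_i\rangle/\langle\bar f_j\rangle=1=\langle\bar f_j\rangle\backslash\langle a_i\rangle$. PARTIAL MAPS. $\lambda^{-1},\rho^{-1}$ are partial maps from $I$ to $J$, so $\rho\circ\lambda^{-1}$ and $\lambda\circ\rho^{-1}$ are partial maps on $I$; an equation $(\rho\circ\lambda^{-1})^m(i)=j$ asserts in particular that the left side is defined; the $0$-th power is the identity. PSEUDO BL-ALGEBRAS. An algebra $(L;\cdot,\backslash,/,\wedge,\vee,0,1)$ of type $\langle 2,2,2,2,2,0,0\rangle$ is a pseudo BL-algebra if $(L;\wedge,\vee,0,1)$ is a bounded lattice; $(L;\cdot,1)$ is a monoid with $xy\le z$ iff $y\le x\backslash z$ iff $x\le z/y$; $x(x\backslash(x\wedge y))=x\wedge y=((x\wedge y)/x)x$; $x(x\backslash y)=x\wedge y=(y/x)x$ (divisibility); and $x\backslash y\vee y\backslash x=1=y/x\vee x/y$ (prelinearity). FILTERS AND SUBDIRECT IRREDUCIBILITY. In a pseudo hoop or a kite $B$, a filter is a nonempty subset closed under $\cdot$ and upward closed. A filter $F$ is normal if for all $a,b\in B$: $b/a\in F$ iff $a\backslash b\in F$.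 Congruences correspond bijectively to normal filters, and $B$ is subdirectly irreducible iff it is trivial (one-element) or has a least normal filter among the normal filters $F\ne\{1\}$.
   Formalization: I is assumed non-empty; (1) is proved equivalent to the kite being subdirectly irreducible for every A, and to (2) when J is empty or A is cancellative, a condition shown to be necessary for the kite to be a pseudo BL-algebra; without it (1) does not imply (2). *)

theory Defs
  imports "HOL-Algebra.Group" "HOL-Library.Equipollence"
begin

record 'a residuated = "'a monoid" +
  ldiv :: "'a \<Rightarrow> 'a \<Rightarrow> 'a" (infix "\<setminus>\<index>" 65)
  rdiv :: "'a \<Rightarrow> 'a \<Rightarrow> 'a" (infix "\<oslash>\<index>" 65)

locale pseudo_hoop =
  fixes A (structure)
  assumes one_closed: "\<one> \<in> carrier A"
    and mult_closed: "\<lbrakk>a \<in> carrier A; b \<in> carrier A\<rbrakk> \<Longrightarrow> a \<otimes> b \<in> carrier A"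
    and ldiv_closed: "\<lbrakk>a \<in> carrier A; b \<in> carrier A\<rbrakk> \<Longrightarrow> a \<setminus> b \<in> carrier A"
    and rdiv_closed: "\<lbrakk>a \<in> carrier A; b \<in> carrier A\<rbrakk> \<Longrightarrow> a \<oslash> b \<in> carrier A"
    and mult_one: "a \<in> carrier A \<Longrightarrow> a \<otimes> \<one> = a"
    and one_mult: "a \<in> carrier A \<Longrightarrow> \<one> \<otimes> a = a"
    and ldiv_self: "a \<in> carrier A \<Longrightarrow> a \<setminus> a = \<one>"
    and rdiv_self: "a \<in> carrier A \<Longrightarrow> a \<oslash> a = \<one>"
    and rdiv_mult: "\<lbrakk>a \<in> carrier A; b \<in> carrier A; c \<in> carrier A\<rbrakk>
                    \<Longrightarrow> c \<oslash> (a \<otimes> b) = (c \<oslash> b) \<oslash> a"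
    and mult_ldiv: "\<lbrakk>a \<in> carrier A; b \<in> carrier A; c \<in> carrier A\<rbrakk>
                    \<Longrightarrow> (a \<otimes> b) \<setminus> c = b \<setminus> (a \<setminus> c)"
    and meet_rdiv: "\<lbrakk>a \<in> carrier A; b \<in> carrier A\<rbrakk> \<Longrightarrow> (b \<oslash> a) \<otimes> a = (a \<oslash> b) \<otimes> b"
    and meet_rdiv_ldiv: "\<lbrakk>a \<in> carrier A; b \<in> carrier A\<rbrakk> \<Longrightarrow> (a \<oslash> b) \<otimes> b = a \<otimes> (a \<setminus> b)"
    and meet_ldiv: "\<lbrakk>a \<in> carrier A; b \<in> carrier A\<rbrakk> \<Longrightarrow> a \<otimes> (a \<setminus> b) = b \<otimes> (b \<setminus> a)"

definition hoop_le :: "('a, 'm) residuated_scheme \<Rightarrow> 'a \<Rightarrow> 'a \<Rightarrow> bool" where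
  "hoop_le A a b \<longleftrightarrow> a \<setminus>\<^bsub>A\<^esub> b = \<one>\<^bsub>A\<^esub>"

locale basic_pseudo_hoop = pseudo_hoop +
  assumes basic_rdiv: "\<lbrakk>a \<in> carrier A; b \<in> carrier A; c \<in> carrier A\<rbrakk>
                       \<Longrightarrow> hoop_le A (c \<oslash> (b \<oslash> a)) (c \<oslash> (c \<oslash> (a \<oslash> b)))"
    and basic_ldiv: "\<lbrakk>a \<in> carrier A; b \<in> carrier A; c \<in> carrier A\<rbrakk>
                     \<Longrightarrow> hoop_le A ((a \<setminus> b) \<setminus> c) (((b \<setminus> a) \<setminus> c) \<setminus> c)"

text \<open>
  In a pseudo BL-algebra, divisibility for a family \<open>a\<close> over \<open>I\<close> and a barred family \<open>f\<close> of a kite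
  forces \<open>(f\<^sub>j a\<^sub>i) / a\<^sub>i = f\<^sub>j\<close> and \<open>a\<^sub>i \<setminus> (a\<^sub>i f\<^sub>j) = f\<^sub>j\<close>, that is, cancellation in the pseudo hoop.
\<close>

definition cancellative :: "('a, 'm) monoid_scheme \<Rightarrow> bool" where
  "cancellative A \<longleftrightarrow>
     (\<forall>a\<in>carrier A. \<forall>b\<in>carrier A. \<forall>c\<in>carrier A.
        (a \<otimes>\<^bsub>A\<^esub> b = a \<otimes>\<^bsub>A\<^esub> c \<longrightarrow> b = c) \<and> (b \<otimes>\<^bsub>A\<^esub> a = c \<otimes>\<^bsub>A\<^esub> a \<longrightarrow> b = c))"


text \<open>
  The order is a parameter of the notions below, because a pseudo hoop is ordered by
  \<^term>\<open>hoop_le\<close>, whereas the order of a kite is part of its construction.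
\<close>

definition hoop_filter ::
  "('b \<Rightarrow> 'b \<Rightarrow> bool) \<Rightarrow> ('b, 'm) monoid_scheme \<Rightarrow> 'b set \<Rightarrow> bool" where
  "hoop_filter leq B F \<longleftrightarrow>
     F \<subseteq> carrier B \<and> F \<noteq> {} \<and>
     (\<forall>x\<in>F. \<forall>y\<in>F. x \<otimes>\<^bsub>B\<^esub> y \<in> F) \<and>
     (\<forall>x\<in>F. \<forall>y\<in>carrier B. leq x y \<longrightarrow> y \<in> F)"

definition normal_filter ::
  "('b \<Rightarrow> 'b \<Rightarrow> bool) \<Rightarrow> ('b, 'm) residuated_scheme \<Rightarrow> 'b set \<Rightarrow> bool" where
  "normal_filter leq B F \<longleftrightarrow>
     hoop_filter leq B F \<and>
     (\<forall>a\<in>carrier B. \<forall>b\<in>carrier B. b \<oslash>\<^bsub>B\<^esub> a \<in> F \<longleftrightarrow> a \<setminus>\<^bsub>B\<^esub> b \<in> F)"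

definition subdirectly_irreducible ::
  "('b \<Rightarrow> 'b \<Rightarrow> bool) \<Rightarrow> ('b, 'm) residuated_scheme \<Rightarrow> bool" where
  "subdirectly_irreducible leq B \<longleftrightarrow>
     (\<exists>x. carrier B = {x}) \<or>
     (\<exists>M. normal_filter leq B M \<and> M \<noteq> {\<one>\<^bsub>B\<^esub>} \<and>
          (\<forall>F. normal_filter leq B F \<and> F \<noteq> {\<one>\<^bsub>B\<^esub>} \<longrightarrow> M \<subseteq> F))"

record 'a bounded_residuated = "'a residuated" +
  lmeet :: "'a \<Rightarrow> 'a \<Rightarrow> 'a" (infixl "\<curlywedge>\<index>" 60)
  ljoin :: "'a \<Rightarrow> 'a \<Rightarrow> 'a" (infixl "\<curlyvee>\<index>" 60)
  lzero :: 'a ("\<zero>\<index>")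

locale pseudo_BL_algebra = monoid L for L (structure) +
  assumes zero_closed: "\<zero> \<in> carrier L"
    and ldiv_closed: "\<lbrakk>x \<in> carrier L; y \<in> carrier L\<rbrakk> \<Longrightarrow> x \<setminus> y \<in> carrier L"
    and rdiv_closed: "\<lbrakk>x \<in> carrier L; y \<in> carrier L\<rbrakk> \<Longrightarrow> x \<oslash> y \<in> carrier L"
    and meet_closed: "\<lbrakk>x \<in> carrier L; y \<in> carrier L\<rbrakk> \<Longrightarrow> x \<curlywedge> y \<in> carrier L"
    and join_closed: "\<lbrakk>x \<in> carrier L; y \<in> carrier L\<rbrakk> \<Longrightarrow> x \<curlyvee> y \<in> carrier L"
    and meet_commute: "\<lbrakk>x \<in> carrier L; y \<in> carrier L\<rbrakk> \<Longrightarrow> x \<curlywedge> y = y \<curlywedge> x"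
    and join_commute: "\<lbrakk>x \<in> carrier L; y \<in> carrier L\<rbrakk> \<Longrightarrow> x \<curlyvee> y = y \<curlyvee> x"
    and meet_assoc: "\<lbrakk>x \<in> carrier L; y \<in> carrier L; z \<in> carrier L\<rbrakk>
                     \<Longrightarrow> (x \<curlywedge> y) \<curlywedge> z = x \<curlywedge> (y \<curlywedge> z)"
    and join_assoc: "\<lbrakk>x \<in> carrier L; y \<in> carrier L; z \<in> carrier L\<rbrakk>
                     \<Longrightarrow> (x \<curlyvee> y) \<curlyvee> z = x \<curlyvee> (y \<curlyvee> z)"
    and meet_join_absorb: "\<lbrakk>x \<in> carrier L; y \<in> carrier L\<rbrakk> \<Longrightarrow> x \<curlywedge> (x \<curlyvee> y) = x"
    and join_meet_absorb: "\<lbrakk>x \<in> carrier L; y \<in> carrier L\<rbrakk> \<Longrightarrow> x \<curlyvee> (x \<curlywedge> y) = x"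
    and zero_least: "x \<in> carrier L \<Longrightarrow> \<zero> \<curlywedge> x = \<zero>"
    and one_greatest: "x \<in> carrier L \<Longrightarrow> x \<curlywedge> \<one> = x"
    \<comment> \<open>\<open>x \<le> y\<close> is spelled out as \<open>x \<curlywedge> y = x\<close>.\<close>
    and residuation_ldiv: "\<lbrakk>x \<in> carrier L; y \<in> carrier L; z \<in> carrier L\<rbrakk>
                           \<Longrightarrow> (x \<otimes> y) \<curlywedge> z = x \<otimes> y \<longleftrightarrow> y \<curlywedge> (x \<setminus> z) = y"
    and residuation_rdiv: "\<lbrakk>x \<in> carrier L; y \<in> carrier L; z \<in> carrier L\<rbrakk>
                           \<Longrightarrow> (x \<otimes> y) \<curlywedge> z = x \<otimes> y \<longleftrightarrow> x \<curlywedge> (z \<oslash> y) = x"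
    and ldiv_meet: "\<lbrakk>x \<in> carrier L; y \<in> carrier L\<rbrakk> \<Longrightarrow> x \<otimes> (x \<setminus> (x \<curlywedge> y)) = x \<curlywedge> y"
    and rdiv_meet: "\<lbrakk>x \<in> carrier L; y \<in> carrier L\<rbrakk> \<Longrightarrow> ((x \<curlywedge> y) \<oslash> x) \<otimes> x = x \<curlywedge> y"
    and divisibility_ldiv: "\<lbrakk>x \<in> carrier L; y \<in> carrier L\<rbrakk> \<Longrightarrow> x \<otimes> (x \<setminus> y) = x \<curlywedge> y"
    and divisibility_rdiv: "\<lbrakk>x \<in> carrier L; y \<in> carrier L\<rbrakk> \<Longrightarrow> (y \<oslash> x) \<otimes> x = x \<curlywedge> y"
    and prelinearity_ldiv: "\<lbrakk>x \<in> carrier L; y \<in> carrier L\<rbrakk> \<Longrightarrow> (x \<setminus> y) \<curlyvee> (y \<setminus> x) = \<one>"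
    and prelinearity_rdiv: "\<lbrakk>x \<in> carrier L; y \<in> carrier L\<rbrakk> \<Longrightarrow> (y \<oslash> x) \<curlyvee> (x \<oslash> y) = \<one>"


definition glb_on :: "('b \<Rightarrow> 'b \<Rightarrow> bool) \<Rightarrow> 'b set \<Rightarrow> 'b \<Rightarrow> 'b \<Rightarrow> 'b" where
  "glb_on leq C x y =
     (THE z. z \<in> C \<and> leq z x \<and> leq z y \<and> (\<forall>w\<in>C. leq w x \<and> leq w y \<longrightarrow> leq w z))"

definition lub_on :: "('b \<Rightarrow> 'b \<Rightarrow> bool) \<Rightarrow> 'b set \<Rightarrow> 'b \<Rightarrow> 'b \<Rightarrow> 'b" where
  "lub_on leq C x y =
     (THE z. z \<in> C \<and> leq x z \<and> leq y z \<and> (\<forall>w\<in>C. leq x w \<and> leq y w \<longrightarrow> leq z w))"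

text \<open>
  Elements of a kite: \<^term>\<open>Inl f\<close> is the barred family
  \<open>\<langle>\<close>bar \<open>f\<^sub>j : j \<in> J\<rangle>\<close> and \<^term>\<open>Inr a\<close> the family \<open>\<langle>a\<^sub>i : i \<in> I\<rangle>\<close>; families are
  extensional functions on the index sets. The arguments \<open>l\<close> and \<open>r\<close> are the maps
  \<open>\<lambda>\<close> and \<open>\<rho>\<close> from \<open>J\<close> to \<open>I\<close>.
\<close>

type_synonym ('a, 'i, 'j) kite_elem = "('j \<Rightarrow> 'a) + ('i \<Rightarrow> 'a)"

definition kite_carrier ::
  "('a, 'm) residuated_scheme \<Rightarrow> 'i set \<Rightarrow> 'j set \<Rightarrow> ('a, 'i, 'j) kite_elem set" where
  "kite_carrier A I J = Inl ` (J \<rightarrow>\<^sub>E carrier A) \<union> Inr ` (I \<rightarrow>\<^sub>E carrier A)"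

fun kite_le :: "('a, 'm) residuated_scheme \<Rightarrow> 'i set \<Rightarrow> 'j set
    \<Rightarrow> ('a, 'i, 'j) kite_elem \<Rightarrow> ('a, 'i, 'j) kite_elem \<Rightarrow> bool" where
  "kite_le A I J (Inr a) (Inr b) = (\<forall>i\<in>I. hoop_le A (a i) (b i))"
| "kite_le A I J (Inl f) (Inl g) = (\<forall>j\<in>J. hoop_le A (g j) (f j))"
| "kite_le A I J (Inl f) (Inr a) = True"
| "kite_le A I J (Inr a) (Inl f) = False"

definition kite_one :: "('a, 'm) residuated_scheme \<Rightarrow> 'i set \<Rightarrow> ('a, 'i, 'j) kite_elem" where
  "kite_one A I = Inr (\<lambda>i\<in>I. \<one>\<^bsub>A\<^esub>)"

definition kite_zero :: "('a, 'm) residuated_scheme \<Rightarrow> 'j set \<Rightarrow> ('a, 'i, 'j) kite_elem" where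
  "kite_zero A J = Inl (\<lambda>j\<in>J. \<one>\<^bsub>A\<^esub>)"

fun kite_mult :: "('a, 'm) residuated_scheme \<Rightarrow> 'i set \<Rightarrow> 'j set \<Rightarrow> ('j \<Rightarrow> 'i) \<Rightarrow> ('j \<Rightarrow> 'i)
    \<Rightarrow> ('a, 'i, 'j) kite_elem \<Rightarrow> ('a, 'i, 'j) kite_elem \<Rightarrow> ('a, 'i, 'j) kite_elem" where
  "kite_mult A I J l r (Inr a) (Inr b) = Inr (\<lambda>i\<in>I. a i \<otimes>\<^bsub>A\<^esub> b i)"
| "kite_mult A I J l r (Inr a) (Inl f) = Inl (\<lambda>j\<in>J. f j \<oslash>\<^bsub>A\<^esub> a (l j))"
| "kite_mult A I J l r (Inl f) (Inr a) = Inl (\<lambda>j\<in>J. a (r j) \<setminus>\<^bsub>A\<^esub> f j)"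
| "kite_mult A I J l r (Inl f) (Inl g) = kite_zero A J"

fun kite_ldiv :: "('a, 'm) residuated_scheme \<Rightarrow> 'i set \<Rightarrow> 'j set \<Rightarrow> ('j \<Rightarrow> 'i) \<Rightarrow> ('j \<Rightarrow> 'i)
    \<Rightarrow> ('a, 'i, 'j) kite_elem \<Rightarrow> ('a, 'i, 'j) kite_elem \<Rightarrow> ('a, 'i, 'j) kite_elem" where
  "kite_ldiv A I J l r (Inr a) (Inr b) = Inr (\<lambda>i\<in>I. a i \<setminus>\<^bsub>A\<^esub> b i)"
| "kite_ldiv A I J l r (Inr a) (Inl f) = Inl (\<lambda>j\<in>J. f j \<otimes>\<^bsub>A\<^esub> a (l j))"
| "kite_ldiv A I J l r (Inl f) (Inl g) =
     Inr (\<lambda>i\<in>I. if i \<in> r ` J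
                then f (the_inv_into J r i) \<oslash>\<^bsub>A\<^esub> g (the_inv_into J r i) else \<one>\<^bsub>A\<^esub>)"
| "kite_ldiv A I J l r (Inl f) (Inr a) = kite_one A I"

text \<open>The numerator comes first: \<open>kite_rdiv A I J l r x y\<close> is \<open>x / y\<close>.\<close>

fun kite_rdiv :: "('a, 'm) residuated_scheme \<Rightarrow> 'i set \<Rightarrow> 'j set \<Rightarrow> ('j \<Rightarrow> 'i) \<Rightarrow> ('j \<Rightarrow> 'i)
    \<Rightarrow> ('a, 'i, 'j) kite_elem \<Rightarrow> ('a, 'i, 'j) kite_elem \<Rightarrow> ('a, 'i, 'j) kite_elem" where
  "kite_rdiv A I J l r (Inr b) (Inr a) = Inr (\<lambda>i\<in>I. b i \<oslash>\<^bsub>A\<^esub> a i)"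
| "kite_rdiv A I J l r (Inl f) (Inr a) = Inl (\<lambda>j\<in>J. a (r j) \<otimes>\<^bsub>A\<^esub> f j)"
| "kite_rdiv A I J l r (Inl g) (Inl f) =
     Inr (\<lambda>i\<in>I. if i \<in> l ` J
                then g (the_inv_into J l i) \<setminus>\<^bsub>A\<^esub> f (the_inv_into J l i) else \<one>\<^bsub>A\<^esub>)"
| "kite_rdiv A I J l r (Inr a) (Inl f) = kite_one A I"

definition kite :: "('a, 'm) residuated_scheme \<Rightarrow> 'i set \<Rightarrow> 'j set \<Rightarrow> ('j \<Rightarrow> 'i) \<Rightarrow> ('j \<Rightarrow> 'i)
    \<Rightarrow> ('a, 'i, 'j) kite_elem bounded_residuated" where
  "kite A I J l r =
     \<lparr>carrier = kite_carrier A I J,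
      mult = kite_mult A I J l r,
      one = kite_one A I,
      ldiv = kite_ldiv A I J l r,
      rdiv = kite_rdiv A I J l r,
      lmeet = glb_on (kite_le A I J) (kite_carrier A I J),
      ljoin = lub_on (kite_le A I J) (kite_carrier A I J),
      lzero = kite_zero A J\<rparr>"


definition partial_inv :: "'j set \<Rightarrow> ('j \<Rightarrow> 'i) \<Rightarrow> 'i \<Rightarrow> 'j option" where
  "partial_inv J h i = (if i \<in> h ` J then Some (the_inv_into J h i) else None)"

definition partial_power :: "('i \<Rightarrow> 'i option) \<Rightarrow> nat \<Rightarrow> 'i \<Rightarrow> 'i option" where
  "partial_power p m i = ((\<lambda>x. Option.bind x p) ^^ m) (Some i)"

definition connecting_maps :: "'i set \<Rightarrow> 'j set \<Rightarrow> ('j \<Rightarrow> 'i) \<Rightarrow> ('j \<Rightarrow> 'i) \<Rightarrow> bool" where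
  "connecting_maps I J l r \<longleftrightarrow>
     (\<forall>i\<in>I. \<forall>j\<in>I. \<exists>m.
        partial_power (\<lambda>x. map_option r (partial_inv J l x)) m i = Some j \<or>
        partial_power (\<lambda>x. map_option l (partial_inv J r x)) m i = Some j)"

end

theory Submission
  imports Defs
begin

text \<open>
  A normal filter of the kite that contains a barred family contains the bottom, hence is improper;
  any other one is a normal filter \<open>G\<close> of \<open>A\<^sup>I\<close> for which a family over \<open>J\<close>, padded with \<open>1\<close>, lies
  in \<open>G\<close> after transport along \<open>\<lambda>\<close> iff it does so after transport along \<open>\<rho>\<close>. The elements whose
  family concentrated at \<open>i\<close> lies in \<open>G\<close> form a normal filter of \<open>A\<close> which is thus constant along
  the orbits of \<open>\<rho> \<circ> \<lambda>\<inverse>\<close>. If \<open>A\<close> has a least normal filter \<open>N\<close> and there is a single orbit,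
  then the finitely supported families in \<open>N\<close> form the least normal filter of the kite. Conversely,
  families supported in an orbit and in its complement form normal filters meeting only in the unit.
  Cancellation enters only through divisibility in the kite, where the join of \<open>f\<close> and \<open>g\<close> has to
  be \<open>(f / g) \<setminus> f\<close>.
\<close>

section \<open>Pseudo hoops\<close>

context pseudo_hoop
begin

abbreviation le (infix "\<preceq>" 50) where "a \<preceq> b \<equiv> hoop_le A a b"

definition hmeet where "hmeet a b = a \<otimes> (a \<setminus> b)"

lemmas closed [simp, intro] = one_closed mult_closed ldiv_closed rdiv_closed
lemmas units [simp] = mult_one one_mult ldiv_self rdiv_self

lemma le_antisym:
  assumes "a \<in> carrier A" "b \<in> carrier A" "a \<preceq> b" "b \<preceq> a"
  shows "a = b"
  using assms meet_ldiv[of a b] by (simp add: hoop_le_def)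

text \<open>By \<open>mult_ldiv\<close> both bracketings have the same left division into every
  \<open>d\<close>. Taking \<open>d\<close> to be either product gives the two inequalities.\<close>

lemma mult_assoc:
  assumes [simp]: "a \<in> carrier A" "b \<in> carrier A" "c \<in> carrier A"
  shows "(a \<otimes> b) \<otimes> c = a \<otimes> (b \<otimes> c)"
proof -
  have eq: "((a \<otimes> b) \<otimes> c) \<setminus> d = (a \<otimes> (b \<otimes> c)) \<setminus> d" if [simp]: "d \<in> carrier A" for d
    by (simp add: mult_ldiv)
  show ?thesis
    by (rule le_antisym) (simp_all add: hoop_le_def eq, simp flip: eq)
qed

text \<open>With \<open>q = x \<setminus> \<one>\<close> one has
  \<open>\<one> \<setminus> x = x \<otimes> q\<close> and
  \<open>x = (x \<otimes> q) \<otimes> (q \<setminus> \<one>)\<close>. The last factor is absorbed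
  because \<open>q \<otimes> (q \<setminus> \<one>) = q\<close>.\<close>

lemma one_ldiv [simp]:
  assumes [simp]: "x \<in> carrier A"
  shows "\<one> \<setminus> x = x"
proof -
  define q where "q = x \<setminus> \<one>"
  have [simp]: "q \<in> carrier A" by (simp add: q_def)
  have y: "\<one> \<setminus> x = x \<otimes> q"
    using meet_ldiv[of x \<one>] by (simp add: q_def)
  have "\<one> \<setminus> q = q"
    using mult_ldiv[of x \<one> \<one>] by (simp add: q_def)
  then have q: "q \<otimes> (q \<setminus> \<one>) = q"
    using meet_ldiv[of q \<one>] by simp
  have "x \<setminus> (x \<otimes> q) = \<one>"
    using mult_ldiv[of \<one> x x] by (simp flip: y)
  then have "x = (x \<otimes> q) \<otimes> ((x \<otimes> q) \<setminus> x)"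
    using meet_ldiv[of x "x \<otimes> q"] by simp
  also have "(x \<otimes> q) \<setminus> x = q \<setminus> \<one>"
    by (simp add: mult_ldiv)
  also have "(x \<otimes> q) \<otimes> (q \<setminus> \<one>) = x \<otimes> q"
    by (simp add: mult_assoc q)
  finally show ?thesis by (simp add: y)
qed

lemma rdiv_one [simp]: "x \<in> carrier A \<Longrightarrow> x \<oslash> \<one> = x"
  using meet_rdiv[of \<one> x] meet_rdiv_ldiv[of x \<one>] meet_ldiv[of x \<one>] by simp

lemma ldiv_one [simp]:
  assumes [simp]: "x \<in> carrier A"
  shows "x \<setminus> \<one> = \<one>"
proof -
  have "x \<otimes> (x \<setminus> \<one>) = x"
    using meet_ldiv[of x \<one>] by simp
  \<comment> \<open>Writing \<open>x\<close> as this product lets \<open>mult_ldiv\<close> turn the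
    quotient into a self-division.\<close>
  then have "x \<setminus> \<one> = (x \<otimes> (x \<setminus> \<one>)) \<setminus> \<one>" by simp
  also have "\<dots> = \<one>" by (subst mult_ldiv) auto
  finally show ?thesis .
qed

lemma one_rdiv [simp]:
  assumes [simp]: "x \<in> carrier A"
  shows "\<one> \<oslash> x = \<one>"
proof -
  have "(\<one> \<oslash> x) \<otimes> x = x"
    using meet_rdiv[of \<one> x] by simp
  then have "\<one> \<oslash> x = \<one> \<oslash> ((\<one> \<oslash> x) \<otimes> x)" by simp
  also have "\<dots> = \<one>" by (subst rdiv_mult) auto
  finally show ?thesis .
qed

text \<open>The left and right forms of the meet agree, so either condition makes \<open>a\<close> a
  multiple of \<open>b\<close> on the side that the other division needs.\<close>

lemma le_iff_rdiv:
  assumes [simp]: "a \<in> carrier A" "b \<in> carrier A"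
  shows "a \<preceq> b \<longleftrightarrow> b \<oslash> a = \<one>"
proof
  assume "a \<preceq> b"
  then have a: "a = (a \<oslash> b) \<otimes> b"
    by (simp add: hoop_le_def meet_rdiv_ldiv)
  have "b \<oslash> a = b \<oslash> ((a \<oslash> b) \<otimes> b)" using a by simp
  also have "\<dots> = \<one>" by (simp add: rdiv_mult)
  finally show "b \<oslash> a = \<one>" .
next
  assume "b \<oslash> a = \<one>"
  then have a: "a = b \<otimes> (b \<setminus> a)"
    using meet_rdiv[of a b] meet_rdiv_ldiv[of a b] meet_ldiv[of a b] by simp
  have "a \<setminus> b = (b \<otimes> (b \<setminus> a)) \<setminus> b" using a by simp
  also have "\<dots> = \<one>" by (simp add: mult_ldiv)
  finally show "a \<preceq> b" by (simp add: hoop_le_def)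
qed

lemma le_refl [simp]: "a \<in> carrier A \<Longrightarrow> a \<preceq> a"
  by (simp add: hoop_le_def)

lemma le_one [simp]: "a \<in> carrier A \<Longrightarrow> a \<preceq> \<one>"
  by (simp add: hoop_le_def)

lemma one_le_iff [simp]: "a \<in> carrier A \<Longrightarrow> \<one> \<preceq> a \<longleftrightarrow> a = \<one>"
  by (simp add: hoop_le_def)

lemma le_trans:
  assumes [simp]: "a \<in> carrier A" "b \<in> carrier A" "c \<in> carrier A" and "a \<preceq> b" "b \<preceq> c"
  shows "a \<preceq> c"
proof -
  have "a = b \<otimes> (b \<setminus> a)"
    using meet_ldiv[of a b] \<open>a \<preceq> b\<close> by (simp add: hoop_le_def)
  then have "a \<setminus> c = (b \<otimes> (b \<setminus> a)) \<setminus> c" by simp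
  also have "\<dots> = \<one>" using \<open>b \<preceq> c\<close> by (simp add: mult_ldiv hoop_le_def)
  finally show ?thesis by (simp add: hoop_le_def)
qed

lemma residuation_ldiv:
  "\<lbrakk>x \<in> carrier A; y \<in> carrier A; z \<in> carrier A\<rbrakk> \<Longrightarrow> x \<otimes> y \<preceq> z \<longleftrightarrow> y \<preceq> x \<setminus> z"
  by (simp add: hoop_le_def mult_ldiv)

lemma residuation_rdiv:
  "\<lbrakk>x \<in> carrier A; y \<in> carrier A; z \<in> carrier A\<rbrakk> \<Longrightarrow> x \<otimes> y \<preceq> z \<longleftrightarrow> x \<preceq> z \<oslash> y"
  by (simp add: le_iff_rdiv rdiv_mult)

lemma mult_le_left [simp]: "\<lbrakk>x \<in> carrier A; y \<in> carrier A\<rbrakk> \<Longrightarrow> x \<otimes> y \<preceq> x"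
  by (simp add: residuation_ldiv)

lemma mult_le_right [simp]: "\<lbrakk>x \<in> carrier A; y \<in> carrier A\<rbrakk> \<Longrightarrow> x \<otimes> y \<preceq> y"
  by (simp add: residuation_rdiv)

lemma le_ldiv_self [simp]: "\<lbrakk>x \<in> carrier A; y \<in> carrier A\<rbrakk> \<Longrightarrow> x \<preceq> y \<setminus> x"
  by (metis residuation_ldiv mult_le_right)

lemma le_rdiv_self [simp]: "\<lbrakk>x \<in> carrier A; y \<in> carrier A\<rbrakk> \<Longrightarrow> x \<preceq> x \<oslash> y"
  by (metis residuation_rdiv mult_le_left)

lemma eq_if_same_lower_bounds:
  "\<lbrakk>x \<in> carrier A; y \<in> carrier A; \<And>w. w \<in> carrier A \<Longrightarrow> w \<preceq> x \<longleftrightarrow> w \<preceq> y\<rbrakk> \<Longrightarrow> x = y"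
  by (metis le_antisym le_refl)

text \<open>The lower bounds of both sides are the \<open>w\<close> with
  \<open>x \<otimes> w \<otimes> z \<preceq> y\<close>. In the kite this becomes associativity for a
  barred family between two unbarred ones.\<close>

lemma ldiv_rdiv_commute:
  assumes [simp]: "x \<in> carrier A" "y \<in> carrier A" "z \<in> carrier A"
  shows "(x \<setminus> y) \<oslash> z = x \<setminus> (y \<oslash> z)"
proof -
  have "w \<preceq> (x \<setminus> y) \<oslash> z \<longleftrightarrow> w \<preceq> x \<setminus> (y \<oslash> z)" if [simp]: "w \<in> carrier A" for w
    by (simp add: mult_assoc flip: residuation_ldiv residuation_rdiv)
  then show ?thesis by (intro eq_if_same_lower_bounds) auto
qed

lemma hmeet_closed [simp]: "\<lbrakk>a \<in> carrier A; b \<in> carrier A\<rbrakk> \<Longrightarrow> hmeet a b \<in> carrier A"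
  by (simp add: hmeet_def)

text \<open>A common lower bound \<open>c\<close> factors as
  \<open>a \<otimes> (a \<setminus> c)\<close>, and residuation puts \<open>a \<setminus> c\<close>
  below \<open>a \<setminus> b\<close>.\<close>

lemma le_hmeet_iff:
  assumes [simp]: "a \<in> carrier A" "b \<in> carrier A" "c \<in> carrier A"
  shows "c \<preceq> hmeet a b \<longleftrightarrow> c \<preceq> a \<and> c \<preceq> b"
proof safe
  assume c: "c \<preceq> hmeet a b"
  show "c \<preceq> a"
    by (rule le_trans[OF _ _ _ c]) (simp_all add: hmeet_def)
  show "c \<preceq> b"
    by (rule le_trans[OF _ _ _ c]) (simp_all add: hmeet_def meet_ldiv[of a b])
next
  assume "c \<preceq> a" "c \<preceq> b"
  then have c: "c = a \<otimes> (a \<setminus> c)"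
    using meet_ldiv[of c a] by (simp add: hoop_le_def)
  have "a \<setminus> c \<preceq> a \<setminus> b"
    using \<open>c \<preceq> b\<close> c by (metis residuation_ldiv assms closed)
  also have "a \<setminus> b \<preceq> a \<setminus> hmeet a b" 
    by (simp add: hmeet_def flip: residuation_ldiv)
  finally (le_trans[rotated 3]) have "a \<setminus> c \<preceq> a \<setminus> hmeet a b" by simp
  then show "c \<preceq> hmeet a b"
    using c by (metis residuation_ldiv assms closed hmeet_closed)
qed

lemma hmeet_lower:
  assumes [simp]: "a \<in> carrier A" "b \<in> carrier A"
  shows "hmeet a b \<preceq> a" "hmeet a b \<preceq> b"
  using le_hmeet_iff[of a b "hmeet a b"] by simp_all

lemma carrier_normal_filter: "normal_filter (hoop_le A) A (carrier A)"
  by (auto simp: normal_filter_def hoop_filter_def)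

lemma normal_filterD:
  assumes "normal_filter (hoop_le A) A N"
  shows "N \<subseteq> carrier A" "\<one> \<in> N" "\<lbrakk>x \<in> N; y \<in> N\<rbrakk> \<Longrightarrow> x \<otimes> y \<in> N"
    "\<lbrakk>x \<in> N; y \<in> carrier A; x \<preceq> y\<rbrakk> \<Longrightarrow> y \<in> N"
    "\<lbrakk>x \<in> carrier A; y \<in> carrier A\<rbrakk> \<Longrightarrow> y \<oslash> x \<in> N \<longleftrightarrow> x \<setminus> y \<in> N"
  using assms unfolding normal_filter_def hoop_filter_def
  by (blast, metis all_not_in_conv le_one one_closed subsetD, blast+)

end

section \<open>Prelinearity and joins in basic pseudo hoops\<close>

context basic_pseudo_hoop
begin

text \<open>The assumptions turn both inner quotients of \<open>basic_ldiv\<close> into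
  \<open>\<one>\<close>, which leaves \<open>\<one> \<preceq> c\<close>. This is prelinearity
  phrased by upper bounds, before a join is available.\<close>

lemma prelinear_ldiv:
  assumes [simp]: "a \<in> carrier A" "b \<in> carrier A" "c \<in> carrier A"
    and "a \<setminus> b \<preceq> c" "b \<setminus> a \<preceq> c"
  shows "c = \<one>"
  using assms(4,5) basic_ldiv[of a b c] by (simp add: hoop_le_def)

lemma prelinear_rdiv:
  assumes [simp]: "a \<in> carrier A" "b \<in> carrier A" "c \<in> carrier A"
    and "a \<oslash> b \<preceq> c" "b \<oslash> a \<preceq> c"
  shows "c = \<one>"
  using assms(4,5) basic_rdiv[of a b c] by (simp add: le_iff_rdiv)

text \<open>Each of the two elements met here is already an upper bound of \<open>a\<close> and
  \<open>b\<close>; prelinearity makes their meet the least one.\<close>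

definition hjoin where "hjoin a b = hmeet (b \<oslash> (a \<setminus> b)) (a \<oslash> (b \<setminus> a))"

lemma hjoin_closed [simp]: "\<lbrakk>a \<in> carrier A; b \<in> carrier A\<rbrakk> \<Longrightarrow> hjoin a b \<in> carrier A"
  by (simp add: hjoin_def)

lemma hjoin_upper:
  assumes [simp]: "a \<in> carrier A" "b \<in> carrier A"
  shows "a \<preceq> hjoin a b" "b \<preceq> hjoin a b"
  unfolding hjoin_def by (simp_all add: le_hmeet_iff) (simp_all add: residuation_ldiv flip: residuation_rdiv)

text \<open>For leastness, the join \<open>w\<close> satisfies
  \<open>w \<otimes> (a \<setminus> b) \<preceq> b\<close> and
  \<open>w \<otimes> (b \<setminus> a) \<preceq> a\<close>. Hence \<open>w \<setminus> c\<close>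
  bounds both \<open>a \<setminus> b\<close> and \<open>b \<setminus> a\<close>, and prelinearity
  makes it \<open>\<one>\<close>.\<close>

lemma hjoin_le_iff:
  assumes [simp]: "a \<in> carrier A" "b \<in> carrier A" "c \<in> carrier A"
  shows "hjoin a b \<preceq> c \<longleftrightarrow> a \<preceq> c \<and> b \<preceq> c"
proof safe
  assume j: "hjoin a b \<preceq> c"
  show "a \<preceq> c" "b \<preceq> c"
    by (rule le_trans[OF _ _ _ _ j]; simp add: hjoin_upper)+
next
  assume ac: "a \<preceq> c" and bc: "b \<preceq> c"
  define w where "w = hjoin a b"
  have [simp]: "w \<in> carrier A" by (simp add: w_def)
  have w: "w \<preceq> b \<oslash> (a \<setminus> b)" "w \<preceq> a \<oslash> (b \<setminus> a)"
    using le_hmeet_iff[of "b \<oslash> (a \<setminus> b)" "a \<oslash> (b \<setminus> a)" w] by (simp_all add: w_def hjoin_def)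
  have "w \<otimes> (a \<setminus> b) \<preceq> c"
    by (rule le_trans[OF _ _ _ _ bc]) (use w in \<open>simp_all add: residuation_rdiv\<close>)
  moreover have "w \<otimes> (b \<setminus> a) \<preceq> c"
    by (rule le_trans[OF _ _ _ _ ac]) (use w in \<open>simp_all add: residuation_rdiv\<close>)
  ultimately have "w \<setminus> c = \<one>"
    by (intro prelinear_ldiv[of a b]) (simp_all flip: residuation_ldiv)
  then show "hjoin a b \<preceq> c" by (simp add: hoop_le_def w_def)
qed

lemma hjoin_ldiv_ldiv [simp]:
  assumes [simp]: "a \<in> carrier A" "b \<in> carrier A"
  shows "hjoin (a \<setminus> b) (b \<setminus> a) = \<one>"
  by (rule prelinear_ldiv[of a b]) (simp_all add: hjoin_upper)

lemma hjoin_rdiv_rdiv [simp]: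
  assumes [simp]: "a \<in> carrier A" "b \<in> carrier A"
  shows "hjoin (a \<oslash> b) (b \<oslash> a) = \<one>"
  by (rule prelinear_rdiv[of a b]) (simp_all add: hjoin_upper)

lemma hjoin_one_one [simp]: "hjoin \<one> \<one> = \<one>"
  using hjoin_upper[of \<one> \<one>] by simp

end

section \<open>Cancellation and its effect on divisions\<close>

context pseudo_hoop
begin

text \<open>Divisibility always gives
  \<open>((b \<otimes> a) \<oslash> a) \<otimes> a = b \<otimes> a\<close> and its mirror image, so
  cancelling \<open>a\<close> yields the equations; conversely, division recovers the factor. The
  equations are what divisibility in the kite asks for.\<close>

lemma cancellative_iff:
  "cancellative A \<longleftrightarrow> (\<forall>a\<in>carrier A. \<forall>b\<in>carrier A. (b \<otimes> a) \<oslash> a = b \<and> a \<setminus> (a \<otimes> b) = b)"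
proof
  assume c: "cancellative A"
  have "(b \<otimes> a) \<oslash> a = b \<and> a \<setminus> (a \<otimes> b) = b" if [simp]: "a \<in> carrier A" "b \<in> carrier A" for a b
  proof
    have "((b \<otimes> a) \<oslash> a) \<otimes> a = b \<otimes> a"
      using meet_rdiv[of a "b \<otimes> a"] mult_le_right[of b a] by (simp add: le_iff_rdiv)
    then show "(b \<otimes> a) \<oslash> a = b" using c unfolding cancellative_def by (metis closed that)
    have "a \<otimes> (a \<setminus> (a \<otimes> b)) = a \<otimes> b"
      using meet_ldiv[of a "a \<otimes> b"] mult_le_left[of a b] by (simp add: hoop_le_def)
    then show "a \<setminus> (a \<otimes> b) = b" using c unfolding cancellative_def by (metis closed that)
  qed
  then show "\<forall>a\<in>carrier A. \<forall>b\<in>carrier A. (b \<otimes> a) \<oslash> a = b \<and> a \<setminus> (a \<otimes> b) = b" by blast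
next
  assume "\<forall>a\<in>carrier A. \<forall>b\<in>carrier A. (b \<otimes> a) \<oslash> a = b \<and> a \<setminus> (a \<otimes> b) = b"
  then show "cancellative A" unfolding cancellative_def by metis
qed

end

context basic_pseudo_hoop
begin

text \<open>As \<open>f \<preceq> w \<setminus> f\<close> always holds,
  \<open>g \<preceq> w \<setminus> f\<close> iff \<open>s \<preceq> w \<setminus> f\<close>, so
  \<open>f \<oslash> g = f \<oslash> s\<close>. Now \<open>f = (f \<oslash> s) \<otimes> s\<close>,
  and cancellation strips the first factor.\<close>

lemma cancellative_rdiv_ldiv:
  assumes "cancellative A" and [simp]: "f \<in> carrier A" "g \<in> carrier A"
  shows "(f \<oslash> g) \<setminus> f = hjoin f g"
proof -
  define s where "s = hjoin f g"
  have [simp]: "s \<in> carrier A" by (simp add: s_def)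
  have fs: "f \<preceq> s" by (simp add: s_def hjoin_upper)
  have "w \<preceq> f \<oslash> g \<longleftrightarrow> w \<preceq> f \<oslash> s" if [simp]: "w \<in> carrier A" for w
    using hjoin_le_iff[of f g "w \<setminus> f"]
    by (simp add: s_def residuation_ldiv flip: residuation_rdiv)
  then have "f \<oslash> g = f \<oslash> s" by (intro eq_if_same_lower_bounds) auto
  moreover have "(f \<oslash> s) \<otimes> s = f"
    using meet_rdiv[of s f] fs by (simp add: le_iff_rdiv)
  ultimately have "(f \<oslash> g) \<setminus> f = (f \<oslash> g) \<setminus> ((f \<oslash> g) \<otimes> s)" by simp
  then show ?thesis using assms(1) by (simp add: cancellative_iff s_def)
qed

lemma cancellative_ldiv_rdiv:
  assumes "cancellative A" and [simp]: "f \<in> carrier A" "g \<in> carrier A"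
  shows "f \<oslash> (g \<setminus> f) = hjoin f g"
proof -
  define s where "s = hjoin f g"
  have [simp]: "s \<in> carrier A" by (simp add: s_def)
  have fs: "f \<preceq> s" by (simp add: s_def hjoin_upper)
  have "w \<preceq> g \<setminus> f \<longleftrightarrow> w \<preceq> s \<setminus> f" if [simp]: "w \<in> carrier A" for w
    using hjoin_le_iff[of f g "f \<oslash> w"]
    by (simp add: s_def residuation_rdiv flip: residuation_ldiv)
  then have "g \<setminus> f = s \<setminus> f" by (intro eq_if_same_lower_bounds) auto
  moreover have "s \<otimes> (s \<setminus> f) = f"
    using meet_ldiv[of f s] fs by (simp add: hoop_le_def)
  ultimately have "f \<oslash> (g \<setminus> f) = (s \<otimes> (g \<setminus> f)) \<oslash> (g \<setminus> f)" by simp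
  then show ?thesis using assms(1) by (simp add: cancellative_iff s_def)
qed

end


section \<open>Kites as residuated monoids\<close>

locale pseudo_hoop_kite = pseudo_hoop A for A :: "('a, 'm) residuated_scheme" (structure) +
  fixes I :: "'i set" and J :: "'j set" and l r :: "'j \<Rightarrow> 'i"
  assumes l_image: "l ` J \<subseteq> I" and l_inj: "inj_on l J"
    and r_image: "r ` J \<subseteq> I" and r_inj: "inj_on r J"
begin

abbreviation K where "K \<equiv> kite A I J l r"
abbreviation kle where "kle \<equiv> kite_le A I J"

lemma kite_sel [simp]:
  "carrier K = kite_carrier A I J" "mult K = kite_mult A I J l r" "one K = kite_one A I"
  "ldiv K = kite_ldiv A I J l r" "rdiv K = kite_rdiv A I J l r"
  "lmeet K = glb_on kle (kite_carrier A I J)" "ljoin K = lub_on kle (kite_carrier A I J)"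
  "lzero K = kite_zero A J"
  by (simp_all add: kite_def)

lemma index_closed [simp]: "j \<in> J \<Longrightarrow> l j \<in> I" "j \<in> J \<Longrightarrow> r j \<in> I"
  using l_image r_image by auto

lemma in_kite_carrier [simp]:
  "Inl f \<in> kite_carrier A I J \<longleftrightarrow> f \<in> extensional J \<and> (\<forall>j\<in>J. f j \<in> carrier A)"
  "Inr a \<in> kite_carrier A I J \<longleftrightarrow> a \<in> extensional I \<and> (\<forall>i\<in>I. a i \<in> carrier A)"
  by (auto simp: kite_carrier_def PiE_iff)

lemma kite_cases [consumes 1, case_names Inl Inr]:
  assumes "x \<in> kite_carrier A I J"
  obtains f where "x = Inl f" "f \<in> extensional J" "\<And>j. j \<in> J \<Longrightarrow> f j \<in> carrier A"
    | a where "x = Inr a" "a \<in> extensional I" "\<And>i. i \<in> I \<Longrightarrow> a i \<in> carrier A"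
  using assms by (auto simp: kite_carrier_def PiE_iff)

text \<open>The two divisions of barred families differ only in the map and in the hoop division
  used, so they share this transport, with \<open>h\<close> being \<open>l\<close> or
  \<open>r\<close>.\<close>

definition push :: "('j \<Rightarrow> 'i) \<Rightarrow> ('j \<Rightarrow> 'a) \<Rightarrow> 'i \<Rightarrow> 'a" where
  "push h f = (\<lambda>i\<in>I. if i \<in> h ` J then f (the_inv_into J h i) else \<one>)"

lemma push_ext [simp]: "push h f \<in> extensional I"
  by (simp add: push_def)

lemma push_image: "\<lbrakk>inj_on h J; h ` J \<subseteq> I; j \<in> J\<rbrakk> \<Longrightarrow> push h f (h j) = f j"
  by (auto simp: push_def the_inv_into_f_f)

lemma push_lr [simp]: "j \<in> J \<Longrightarrow> push l f (l j) = f j" "j \<in> J \<Longrightarrow> push r f (r j) = f j"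
  using push_image l_image l_inj r_image r_inj by auto

lemma push_outside: "\<lbrakk>i \<in> I; i \<notin> h ` J\<rbrakk> \<Longrightarrow> push h f i = \<one>"
  by (simp add: push_def)

text \<open>The padding value satisfies \<open>P\<close>, so only the image of \<open>h\<close>
  imposes a condition.\<close>

lemma ball_push:
  assumes "inj_on h J" "h ` J \<subseteq> I" "\<And>i. i \<in> I \<Longrightarrow> P i \<one>"
  shows "(\<forall>i\<in>I. P i (push h f i)) \<longleftrightarrow> (\<forall>j\<in>J. P (h j) (f j))"
proof safe
  fix i assume "\<forall>j\<in>J. P (h j) (f j)" "i \<in> I"
  then show "P i (push h f i)"
    using assms by (cases "i \<in> h ` J") (auto simp: push_image push_outside)
next
  fix j assume "\<forall>i\<in>I. P i (push h f i)" "j \<in> J"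
  then show "P (h j) (f j)"
    using assms(1,2) push_image[of h j f] by (metis image_subset_iff)
qed

lemmas ball_push_l = ball_push[OF l_inj l_image]
lemmas ball_push_r = ball_push[OF r_inj r_image]

lemma push_closed [simp]:
  assumes "\<And>j. j \<in> J \<Longrightarrow> f j \<in> carrier A" "i \<in> I"
  shows "push l f i \<in> carrier A" "push r f i \<in> carrier A"
  using assms ball_push_l[of "\<lambda>i x. x \<in> carrier A" f] ball_push_r[of "\<lambda>i x. x \<in> carrier A" f] by auto

text \<open>These equations replace the defining ones as simp rules, so that
  \<open>the_inv_into\<close> stays hidden behind \<open>push\<close>.\<close>

lemma kite_div_push:
  "kite_ldiv A I J l r (Inl f) (Inl g) = Inr (push r (\<lambda>j. f j \<oslash> g j))"
  "kite_rdiv A I J l r (Inl g) (Inl f) = Inr (push l (\<lambda>j. g j \<setminus> f j))"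
  by (simp_all add: push_def)

declare kite_ldiv.simps(3) [simp del] kite_rdiv.simps(3) [simp del]
declare kite_div_push [simp]

lemma kite_one_closed [simp]: "kite_one A I \<in> kite_carrier A I J"
  by (simp add: kite_one_def)

lemma kite_zero_closed [simp]: "kite_zero A J \<in> kite_carrier A I J"
  by (simp add: kite_zero_def)

lemma kite_closed [simp]:
  "\<lbrakk>x \<in> kite_carrier A I J; y \<in> kite_carrier A I J\<rbrakk> \<Longrightarrow> kite_mult A I J l r x y \<in> kite_carrier A I J"
  "\<lbrakk>x \<in> kite_carrier A I J; y \<in> kite_carrier A I J\<rbrakk> \<Longrightarrow> kite_ldiv A I J l r x y \<in> kite_carrier A I J"
  "\<lbrakk>x \<in> kite_carrier A I J; y \<in> kite_carrier A I J\<rbrakk> \<Longrightarrow> kite_rdiv A I J l r x y \<in> kite_carrier A I J"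
  by (elim kite_cases; simp)+

text \<open>With exactly one barred factor, its position decides between \<open>rdiv_mult\<close>,
  \<open>ldiv_rdiv_commute\<close> and \<open>mult_ldiv\<close>. With two or more, both sides are
  the bottom.\<close>

lemma kite_mult_assoc:
  assumes "x \<in> kite_carrier A I J" "y \<in> kite_carrier A I J" "z \<in> kite_carrier A I J"
  shows "kite_mult A I J l r (kite_mult A I J l r x y) z
    = kite_mult A I J l r x (kite_mult A I J l r y z)"
  using assms
  by (elim kite_cases)
    (auto simp: mult_assoc kite_zero_def rdiv_mult mult_ldiv ldiv_rdiv_commute intro!: restrict_ext)

lemma kite_unit:
  "x \<in> kite_carrier A I J \<Longrightarrow> kite_mult A I J l r (kite_one A I) x = x"
  "x \<in> kite_carrier A I J \<Longrightarrow> kite_mult A I J l r x (kite_one A I) = x"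
  by (elim kite_cases; auto simp: kite_one_def intro: extensionalityI[of _ I] extensionalityI[of _ J])+

lemma le_push:
  "(\<forall>i\<in>I. a i \<in> carrier A) \<Longrightarrow> (\<forall>i\<in>I. a i \<preceq> push l f i) \<longleftrightarrow> (\<forall>j\<in>J. a (l j) \<preceq> f j)"
  "(\<forall>i\<in>I. a i \<in> carrier A) \<Longrightarrow> (\<forall>i\<in>I. a i \<preceq> push r f i) \<longleftrightarrow> (\<forall>j\<in>J. a (r j) \<preceq> f j)"
  using ball_push_l[of "\<lambda>i x. a i \<preceq> x"] ball_push_r[of "\<lambda>i x. a i \<preceq> x"] by auto

lemma kite_residuation:
  "\<lbrakk>x \<in> kite_carrier A I J; y \<in> kite_carrier A I J; z \<in> kite_carrier A I J\<rbrakk>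
    \<Longrightarrow> kle (kite_mult A I J l r x y) z \<longleftrightarrow> kle y (kite_ldiv A I J l r x z)"
  "\<lbrakk>x \<in> kite_carrier A I J; y \<in> kite_carrier A I J; z \<in> kite_carrier A I J\<rbrakk>
    \<Longrightarrow> kle (kite_mult A I J l r x y) z \<longleftrightarrow> kle x (kite_rdiv A I J l r z y)"
  by (elim kite_cases;
    simp add: kite_one_def kite_zero_def le_push flip: residuation_ldiv residuation_rdiv)+

lemma kite_le_refl [simp]: "x \<in> kite_carrier A I J \<Longrightarrow> kle x x"
  by (elim kite_cases) auto

lemma kite_le_antisym:
  "\<lbrakk>x \<in> kite_carrier A I J; y \<in> kite_carrier A I J; kle x y; kle y x\<rbrakk> \<Longrightarrow> x = y"
  by (elim kite_cases)
    (auto intro!: extensionalityI[of _ I] extensionalityI[of _ J] intro: le_antisym)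

lemma kite_le_one [simp]: "x \<in> kite_carrier A I J \<Longrightarrow> kle x (kite_one A I)"
  by (elim kite_cases) (auto simp: kite_one_def)

lemma kite_zero_le [simp]: "x \<in> kite_carrier A I J \<Longrightarrow> kle (kite_zero A J) x"
  by (elim kite_cases) (auto simp: kite_zero_def)

text \<open>Antisymmetry supplies the uniqueness demanded by the \<open>THE\<close> in
  \<open>glb_on\<close>.\<close>

lemma kite_glb_eqI:
  assumes "z \<in> kite_carrier A I J" "kle z x" "kle z y"
    "\<And>w. \<lbrakk>w \<in> kite_carrier A I J; kle w x; kle w y\<rbrakk> \<Longrightarrow> kle w z"
  shows "glb_on kle (kite_carrier A I J) x y = z"
  unfolding glb_on_def using assms kite_le_antisym by (intro the_equality) blast+

lemma kite_lub_eqI: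
  assumes "z \<in> kite_carrier A I J" "kle x z" "kle y z"
    "\<And>w. \<lbrakk>w \<in> kite_carrier A I J; kle x w; kle y w\<rbrakk> \<Longrightarrow> kle z w"
  shows "lub_on kle (kite_carrier A I J) x y = z"
  unfolding lub_on_def using assms kite_le_antisym by (intro the_equality) blast+

text \<open>Divisibility is tested on the constant family \<open>a\<close> and the constant barred
  family \<open>b\<close>. The barred one is their meet, so at any index of \<open>J\<close> the two
  laws become the equations of \<open>cancellative_iff\<close>.\<close>

lemma pseudo_BL_kite_imp_cancellative:
  assumes "pseudo_BL_algebra K" "J \<noteq> {}"
  shows "cancellative A"
  unfolding cancellative_iff
proof (intro ballI)
  fix a b assume [simp]: "a \<in> carrier A" "b \<in> carrier A"
  obtain j where j: "j \<in> J" using assms by blast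
  let ?x = "Inr (\<lambda>i\<in>I. a) :: ('a, 'i, 'j) kite_elem"
  let ?y = "Inl (\<lambda>j\<in>J. b) :: ('a, 'i, 'j) kite_elem"
  have glb: "glb_on kle (kite_carrier A I J) ?x ?y = ?y"
    by (rule kite_glb_eqI) simp_all
  have "kite_mult A I J l r ?x (kite_ldiv A I J l r ?x ?y) = ?y"
    "kite_mult A I J l r (kite_rdiv A I J l r ?y ?x) ?x = ?y"
    using pseudo_BL_algebra.divisibility_ldiv[OF assms(1), of ?x ?y]
      pseudo_BL_algebra.divisibility_rdiv[OF assms(1), of ?x ?y]
    by (simp_all add: glb)
  then show "(b \<otimes> a) \<oslash> a = b \<and> a \<setminus> (a \<otimes> b) = b"
    using j by (auto dest!: fun_cong[of _ _ j])
qed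

end


section \<open>Kites of cancellative basic pseudo hoops\<close>

locale basic_pseudo_hoop_kite =
  pseudo_hoop_kite A I J l r + basic_pseudo_hoop A
  for A :: "('a, 'm) residuated_scheme" (structure)
    and I :: "'i set" and J :: "'j set" and l r :: "'j \<Rightarrow> 'i"
begin

abbreviation kmeet where "kmeet \<equiv> glb_on kle (kite_carrier A I J)"
abbreviation kjoin where "kjoin \<equiv> lub_on kle (kite_carrier A I J)"

text \<open>The order of barred families is reversed, so their meet is computed by joins in the
  hoop.\<close>

lemma kmeet_simps [simp]:
  "\<lbrakk>Inr a \<in> kite_carrier A I J; Inr b \<in> kite_carrier A I J\<rbrakk>
    \<Longrightarrow> kmeet (Inr a) (Inr b) = Inr (\<lambda>i\<in>I. hmeet (a i) (b i))"
  "\<lbrakk>Inl f \<in> kite_carrier A I J; Inl g \<in> kite_carrier A I J\<rbrakk>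
    \<Longrightarrow> kmeet (Inl f) (Inl g) = Inl (\<lambda>j\<in>J. hjoin (f j) (g j))"
  "\<lbrakk>Inl f \<in> kite_carrier A I J; Inr a \<in> kite_carrier A I J\<rbrakk> \<Longrightarrow> kmeet (Inl f) (Inr a) = Inl f"
  "\<lbrakk>Inl f \<in> kite_carrier A I J; Inr a \<in> kite_carrier A I J\<rbrakk> \<Longrightarrow> kmeet (Inr a) (Inl f) = Inl f"
  by (rule kite_glb_eqI; (elim kite_cases)?; simp add: le_hmeet_iff hjoin_le_iff hmeet_lower hjoin_upper)+

lemma kjoin_simps [simp]:
  "\<lbrakk>Inr a \<in> kite_carrier A I J; Inr b \<in> kite_carrier A I J\<rbrakk>
    \<Longrightarrow> kjoin (Inr a) (Inr b) = Inr (\<lambda>i\<in>I. hjoin (a i) (b i))"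
  "\<lbrakk>Inl f \<in> kite_carrier A I J; Inl g \<in> kite_carrier A I J\<rbrakk>
    \<Longrightarrow> kjoin (Inl f) (Inl g) = Inl (\<lambda>j\<in>J. hmeet (f j) (g j))"
  "\<lbrakk>Inl f \<in> kite_carrier A I J; Inr a \<in> kite_carrier A I J\<rbrakk> \<Longrightarrow> kjoin (Inl f) (Inr a) = Inr a"
  "\<lbrakk>Inl f \<in> kite_carrier A I J; Inr a \<in> kite_carrier A I J\<rbrakk> \<Longrightarrow> kjoin (Inr a) (Inl f) = Inr a"
  by (rule kite_lub_eqI; (elim kite_cases)?; simp add: le_hmeet_iff hjoin_le_iff hmeet_lower hjoin_upper)+

lemma kmeet_closed [simp]:
  "\<lbrakk>x \<in> kite_carrier A I J; y \<in> kite_carrier A I J\<rbrakk> \<Longrightarrow> kmeet x y \<in> kite_carrier A I J"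
  by (elim kite_cases) simp_all

lemma kjoin_closed [simp]:
  "\<lbrakk>x \<in> kite_carrier A I J; y \<in> kite_carrier A I J\<rbrakk> \<Longrightarrow> kjoin x y \<in> kite_carrier A I J"
  by (elim kite_cases) simp_all

lemma kle_kmeet_iff:
  "\<lbrakk>x \<in> kite_carrier A I J; y \<in> kite_carrier A I J; w \<in> kite_carrier A I J\<rbrakk>
    \<Longrightarrow> kle w (kmeet x y) \<longleftrightarrow> kle w x \<and> kle w y"
  by (elim kite_cases; auto simp: le_hmeet_iff hjoin_le_iff)

lemma kjoin_kle_iff:
  "\<lbrakk>x \<in> kite_carrier A I J; y \<in> kite_carrier A I J; w \<in> kite_carrier A I J\<rbrakk>
    \<Longrightarrow> kle (kjoin x y) w \<longleftrightarrow> kle x w \<and> kle y w"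
  by (elim kite_cases; auto simp: le_hmeet_iff hjoin_le_iff)

text \<open>Reduces the laws for meets to propositional reasoning with
  \<open>kle_kmeet_iff\<close>.\<close>

lemma eq_if_same_kite_lower_bounds:
  "\<lbrakk>x \<in> kite_carrier A I J; y \<in> kite_carrier A I J;
    \<And>w. w \<in> kite_carrier A I J \<Longrightarrow> kle w x \<longleftrightarrow> kle w y\<rbrakk> \<Longrightarrow> x = y"
  by (metis kite_le_antisym kite_le_refl)

lemma eq_if_same_kite_upper_bounds:
  "\<lbrakk>x \<in> kite_carrier A I J; y \<in> kite_carrier A I J;
    \<And>w. w \<in> kite_carrier A I J \<Longrightarrow> kle x w \<longleftrightarrow> kle y w\<rbrakk> \<Longrightarrow> x = y"
  by (metis kite_le_antisym kite_le_refl)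

text \<open>Translates between the algebraic order used in \<open>pseudo_BL_algebra\<close> and
  \<open>kle\<close>.\<close>

lemma kmeet_eq_left_iff:
  assumes "x \<in> kite_carrier A I J" "y \<in> kite_carrier A I J"
  shows "kmeet x y = x \<longleftrightarrow> kle x y"
  using assms kle_kmeet_iff[of x y x] kle_kmeet_iff[of x y "kmeet x y"]
  by (metis kite_le_antisym kite_le_refl kmeet_closed)

lemma kmeet_commute:
  "\<lbrakk>x \<in> kite_carrier A I J; y \<in> kite_carrier A I J\<rbrakk> \<Longrightarrow> kmeet x y = kmeet y x"
  by (rule eq_if_same_kite_lower_bounds) (auto simp: kle_kmeet_iff)

lemma kjoin_commute:
  "\<lbrakk>x \<in> kite_carrier A I J; y \<in> kite_carrier A I J\<rbrakk> \<Longrightarrow> kjoin x y = kjoin y x"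
  by (rule eq_if_same_kite_upper_bounds) (auto simp: kjoin_kle_iff)

lemma kmeet_assoc:
  "\<lbrakk>x \<in> kite_carrier A I J; y \<in> kite_carrier A I J; z \<in> kite_carrier A I J\<rbrakk>
    \<Longrightarrow> kmeet (kmeet x y) z = kmeet x (kmeet y z)"
  by (rule eq_if_same_kite_lower_bounds) (auto simp: kle_kmeet_iff)

lemma kjoin_assoc:
  "\<lbrakk>x \<in> kite_carrier A I J; y \<in> kite_carrier A I J; z \<in> kite_carrier A I J\<rbrakk>
    \<Longrightarrow> kjoin (kjoin x y) z = kjoin x (kjoin y z)"
  by (rule eq_if_same_kite_upper_bounds) (auto simp: kjoin_kle_iff)

lemma kjoin_upper:
  assumes "x \<in> kite_carrier A I J" "y \<in> kite_carrier A I J"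
  shows "kle x (kjoin x y)"
  using assms kjoin_kle_iff[of x y "kjoin x y"] by simp

lemma kmeet_kjoin_absorb:
  "\<lbrakk>x \<in> kite_carrier A I J; y \<in> kite_carrier A I J\<rbrakk> \<Longrightarrow> kmeet x (kjoin x y) = x"
  by (simp add: kmeet_eq_left_iff kjoin_upper)

lemma kjoin_kmeet_absorb:
  assumes "x \<in> kite_carrier A I J" "y \<in> kite_carrier A I J"
  shows "kjoin x (kmeet x y) = x"
proof -
  have "kle (kmeet x y) x"
    using assms kle_kmeet_iff[of x y "kmeet x y"] by simp
  then show ?thesis
    using assms kjoin_kle_iff[of x "kmeet x y" x] kjoin_upper[of x "kmeet x y"]
    by (intro kite_le_antisym) auto
qed

lemma hjoin_push:
  assumes "\<And>j. j \<in> J \<Longrightarrow> hjoin (u j) (v j) = \<one>" "i \<in> I"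
  shows "hjoin (push l u i) (push l v i) = \<one>" "hjoin (push r u i) (push r v i) = \<one>"
  using assms
  by (cases "i \<in> l ` J", auto simp: push_outside) (cases "i \<in> r ` J", auto simp: push_outside)

text \<open>For a mixed pair one of the two quotients is already the unit; the other cases are
  coordinatewise.\<close>

lemma kite_prelinearity:
  "\<lbrakk>x \<in> kite_carrier A I J; y \<in> kite_carrier A I J\<rbrakk>
    \<Longrightarrow> kjoin (kite_ldiv A I J l r x y) (kite_ldiv A I J l r y x) = kite_one A I"
  "\<lbrakk>x \<in> kite_carrier A I J; y \<in> kite_carrier A I J\<rbrakk>
    \<Longrightarrow> kjoin (kite_rdiv A I J l r y x) (kite_rdiv A I J l r x y) = kite_one A I"
  by (elim kite_cases; auto simp: kite_one_def hjoin_push intro!: restrict_ext)+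

lemma kite_divisibility:
  assumes "J = {} \<or> cancellative A" "x \<in> kite_carrier A I J" "y \<in> kite_carrier A I J"
  shows "kite_mult A I J l r x (kite_ldiv A I J l r x y) = kmeet x y"
    "kite_mult A I J l r (kite_rdiv A I J l r y x) x = kmeet x y"
proof -
  \<comment> \<open>Cancellation is only invoked at an index of \<open>J\<close>, and such an index
    rules out \<open>J = {}\<close>.\<close>
  have c: "cancellative A" if "j \<in> J" for j
    using assms(1) that by auto
  have cc: "(b \<otimes> a) \<oslash> a = b" "a \<setminus> (a \<otimes> b) = b" if "j \<in> J" "a \<in> carrier A" "b \<in> carrier A" for j a b
    using c[OF that(1)] that by (auto simp: cancellative_iff)
  have "kite_mult A I J l r x (kite_ldiv A I J l r x y) = kmeet x y \<and>
    kite_mult A I J l r (kite_rdiv A I J l r y x) x = kmeet x y"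
    using assms(2,3)
    by (elim kite_cases)
      (auto simp: hmeet_def meet_rdiv meet_rdiv_ldiv kite_one_def cc
         cancellative_rdiv_ldiv[OF c] cancellative_ldiv_rdiv[OF c]
        intro!: restrict_ext intro: extensionalityI[of _ J])
  then show "kite_mult A I J l r x (kite_ldiv A I J l r x y) = kmeet x y"
    "kite_mult A I J l r (kite_rdiv A I J l r y x) x = kmeet x y" by blast+
qed

lemma kite_pseudo_BL:
  assumes "J = {} \<or> cancellative A"
  shows "pseudo_BL_algebra K"
proof -
  \<comment> \<open>The axioms \<open>ldiv_meet\<close> and \<open>rdiv_meet\<close> are
    divisibility for \<open>x\<close> and \<open>kmeet x y\<close>, up to this identity.\<close>
  have idem: "kmeet x (kmeet x y) = kmeet x y"
    if "x \<in> kite_carrier A I J" "y \<in> kite_carrier A I J" for x y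
    using that by (intro eq_if_same_kite_lower_bounds) (auto simp: kle_kmeet_iff)
  show ?thesis
    by unfold_locales
      (simp_all add: kite_mult_assoc kite_unit kmeet_assoc kjoin_assoc
        kmeet_kjoin_absorb kjoin_kmeet_absorb kmeet_eq_left_iff kite_prelinearity
        kite_divisibility[OF assms] idem kite_residuation(1)
        flip: kite_residuation(2), (intro kmeet_commute kjoin_commute; assumption)+)
qed

end


section \<open>Normal filters of kites\<close>

context pseudo_hoop_kite
begin

text \<open>The set \<open>S\<close> plays the role of an ideal of admissible supports. It is later
  the finite sets or a powerset.\<close>

definition supported :: "'a set \<Rightarrow> 'i set set \<Rightarrow> ('a, 'i, 'j) kite_elem set" where
  "supported N S = Inr ` {a \<in> extensional I. (\<forall>i\<in>I. a i \<in> N) \<and> {i\<in>I. a i \<noteq> \<one>} \<in> S}"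

lemma in_supported [simp]:
  "Inl f \<notin> supported N S"
  "Inr a \<in> supported N S \<longleftrightarrow> a \<in> extensional I \<and> (\<forall>i\<in>I. a i \<in> N) \<and> {i\<in>I. a i \<noteq> \<one>} \<in> S"
  by (auto simp: supported_def)

lemma push_support:
  assumes "inj_on h J" "h ` J \<subseteq> I"
  shows "{i\<in>I. push h u i \<noteq> \<one>} = h ` {j\<in>J. u j \<noteq> \<one>}"
proof -
  have "i \<in> h ` {j\<in>J. u j \<noteq> \<one>}" if "i \<in> I" "push h u i \<noteq> \<one>" for i
    using assms that by (cases "i \<in> h ` J") (auto simp: push_image push_outside)
  then show ?thesis using assms by (auto simp: push_image)
qed

text \<open>The critical case of normality is a pair of barred families. Both quotients are
  \<open>\<one>\<close> at the same indices of \<open>J\<close>, so their supports are the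
  \<open>l\<close>- and \<open>r\<close>-images of one set, which is where \<open>lr\<close> enters;
  the values are handled by normality of \<open>N\<close>.\<close>

lemma supported_normal_filter:
  assumes N: "normal_filter (hoop_le A) A N"
    and empty: "{} \<in> S" and Un: "\<And>T U. \<lbrakk>T \<in> S; U \<in> S\<rbrakk> \<Longrightarrow> T \<union> U \<in> S"
    and down: "\<And>T U. \<lbrakk>T \<in> S; U \<subseteq> T\<rbrakk> \<Longrightarrow> U \<in> S"
    and lr: "\<And>T. T \<subseteq> J \<Longrightarrow> l ` T \<in> S \<longleftrightarrow> r ` T \<in> S"
  shows "normal_filter kle K (supported N S)"
proof -
  note N_one = normal_filterD(2)[OF N]
  have N_carrier: "x \<in> N \<Longrightarrow> x \<in> carrier A" for x
    using normal_filterD(1)[OF N] by blast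
  have sub: "x \<in> supported N S \<Longrightarrow> x \<in> kite_carrier A I J" for x
    using N_carrier by (auto simp: supported_def)
  have one: "kite_one A I \<in> supported N S"
    using empty N_one by (simp add: kite_one_def cong: conj_cong)
  have mult: "kite_mult A I J l r x y \<in> supported N S"
    if xy: "x \<in> supported N S" "y \<in> supported N S" for x y
  proof -
    obtain a where [simp]: "x = Inr a"
      using xy by (auto simp: supported_def)
    obtain b where [simp]: "y = Inr b"
      using xy by (auto simp: supported_def)
    have "{i\<in>I. a i \<noteq> \<one>} \<union> {i\<in>I. b i \<noteq> \<one>} \<in> S"
      using that by (intro Un) simp_all
    then have "{i\<in>I. a i \<otimes> b i \<noteq> \<one>} \<in> S"
      by (rule down) auto
    then show ?thesis
      using that normal_filterD(3)[OF N] by (simp cong: conj_cong)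
  qed
  have up: "y \<in> supported N S"
    if xy: "x \<in> supported N S" "y \<in> kite_carrier A I J" "kle x y" for x y
  proof -
    obtain a where [simp]: "x = Inr a"
      using xy by (auto simp: supported_def)
    obtain b where [simp]: "y = Inr b"
      using xy by (cases y) auto
    have bN: "\<forall>i\<in>I. b i \<in> N"
      using that normal_filterD(4)[OF N] by auto
    have "{i\<in>I. a i \<noteq> \<one>} \<in> S"
      using that by simp
    then have "{i\<in>I. b i \<noteq> \<one>} \<in> S"
      by (rule down) (use that in auto)
    then show ?thesis using that bN by simp
  qed
  have div_one: "b \<oslash> a = \<one> \<longleftrightarrow> a \<setminus> b = \<one>" if "a \<in> carrier A" "b \<in> carrier A" for a b
    using le_iff_rdiv[OF that] by (simp add: hoop_le_def)
  have normal: "kite_rdiv A I J l r y x \<in> supported N S \<longleftrightarrow> kite_ldiv A I J l r x y \<in> supported N S"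
    if "x \<in> kite_carrier A I J" "y \<in> kite_carrier A I J" for x y
    using that
  proof (elim kite_cases)
    fix f g
    assume [simp]: "x = Inl f" "y = Inl g"
      and fg: "\<And>j. j \<in> J \<Longrightarrow> f j \<in> carrier A" "\<And>j. j \<in> J \<Longrightarrow> g j \<in> carrier A"
    have "(\<forall>i\<in>I. push l (\<lambda>j. g j \<setminus> f j) i \<in> N) \<longleftrightarrow> (\<forall>i\<in>I. push r (\<lambda>j. f j \<oslash> g j) i \<in> N)"
      using fg normal_filterD(5)[OF N]
      by (simp add: ball_push_l[where P = "\<lambda>i x. x \<in> N"] ball_push_r[where P = "\<lambda>i x. x \<in> N"] N_one)
    moreover have "{j\<in>J. g j \<setminus> f j \<noteq> \<one>} = {j\<in>J. f j \<oslash> g j \<noteq> \<one>}"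
      using fg div_one by auto
    ultimately show ?thesis
      by (simp add: push_support l_inj l_image r_inj r_image lr)
  next
    fix a b
    assume [simp]: "x = Inr a" "y = Inr b"
      and ab: "\<And>i. i \<in> I \<Longrightarrow> a i \<in> carrier A" "\<And>i. i \<in> I \<Longrightarrow> b i \<in> carrier A"
    have "{i\<in>I. b i \<oslash> a i \<noteq> \<one>} = {i\<in>I. a i \<setminus> b i \<noteq> \<one>}"
      using ab div_one by auto
    then show ?thesis
      using ab normal_filterD(5)[OF N] by (simp cong: conj_cong)
  qed (simp_all add: one)
  show ?thesis
    unfolding normal_filter_def hoop_filter_def kite_sel
    using sub one mult up normal by blast
qed

section \<open>Families concentrated at one index\<close>

definition spike :: "'i \<Rightarrow> 'a \<Rightarrow> 'i \<Rightarrow> 'a" where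
  "spike i x = (\<lambda>k\<in>I. if k = i then x else \<one>)"

lemma spike_closed: "x \<in> carrier A \<Longrightarrow> Inr (spike i x) \<in> kite_carrier A I J"
  by (simp add: spike_def)

lemma kite_normal_filterD:
  assumes "normal_filter kle K F"
  shows "F \<subseteq> kite_carrier A I J" "kite_one A I \<in> F"
    "\<lbrakk>x \<in> F; y \<in> F\<rbrakk> \<Longrightarrow> kite_mult A I J l r x y \<in> F"
    "\<lbrakk>x \<in> F; y \<in> kite_carrier A I J; kle x y\<rbrakk> \<Longrightarrow> y \<in> F"
    "\<lbrakk>x \<in> kite_carrier A I J; y \<in> kite_carrier A I J\<rbrakk>
      \<Longrightarrow> kite_rdiv A I J l r y x \<in> F \<longleftrightarrow> kite_ldiv A I J l r x y \<in> F"
  using assms unfolding normal_filter_def hoop_filter_def kite_sel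
  by (blast, metis all_not_in_conv kite_le_one kite_one_closed subsetD, blast+)

text \<open>For fixed \<open>i\<close>, \<open>spike\<close> commutes with the product and both
  divisions, since these fix \<open>\<one>\<close> at the other indices. The filter conditions
  therefore pull back to \<open>A\<close>.\<close>

lemma spike_normal_filter:
  assumes F: "normal_filter kle K F" and i: "i \<in> I"
  shows "normal_filter (hoop_le A) A {x \<in> carrier A. Inr (spike i x) \<in> F}"
proof -
  note FD = kite_normal_filterD[OF F]
  have one: "Inr (spike i \<one>) = (kite_one A I :: ('a, 'i, 'j) kite_elem)"
    by (auto simp: spike_def kite_one_def intro!: restrict_ext)
  have mult: "Inr (spike i (x \<otimes> y)) \<in> F"
    if "x \<in> carrier A" "y \<in> carrier A" "Inr (spike i x) \<in> F" "Inr (spike i y) \<in> F" for x y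
  proof -
    have "kite_mult A I J l r (Inr (spike i x)) (Inr (spike i y)) = Inr (spike i (x \<otimes> y))"
      by (auto simp: spike_def intro!: restrict_ext)
    then show ?thesis using FD(3)[OF that(3,4)] by simp
  qed
  have up: "Inr (spike i y) \<in> F"
    if "x \<in> carrier A" "y \<in> carrier A" "Inr (spike i x) \<in> F" "x \<preceq> y" for x y
    by (rule FD(4)[OF that(3)]) (use that in \<open>auto simp: spike_def\<close>)
  have normal: "Inr (spike i (y \<oslash> x)) \<in> F \<longleftrightarrow> Inr (spike i (x \<setminus> y)) \<in> F"
    if "x \<in> carrier A" "y \<in> carrier A" for x y
  proof -
    have "kite_rdiv A I J l r (Inr (spike i y)) (Inr (spike i x)) = Inr (spike i (y \<oslash> x))"
      "kite_ldiv A I J l r (Inr (spike i x)) (Inr (spike i y)) = Inr (spike i (x \<setminus> y))"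
      by (auto simp: spike_def intro!: restrict_ext)
    then show ?thesis using FD(5)[OF spike_closed[OF that(1), of i] spike_closed[OF that(2), of i]] by simp
  qed
  show ?thesis
    unfolding normal_filter_def hoop_filter_def
  proof (intro conjI ballI impI)
    have "\<one> \<in> {x \<in> carrier A. Inr (spike i x) \<in> F}" using one FD(2) by simp
    then show "{x \<in> carrier A. Inr (spike i x) \<in> F} \<noteq> {}" by blast
  qed (auto simp: mult normal dest: up)
qed

text \<open>Let \<open>f\<close> be the barred family with \<open>x\<close> at \<open>j\<close> and
  \<open>\<one>\<close> elsewhere. Dividing the bottom by \<open>f\<close> from the two sides yields
  the spikes at \<open>l j\<close> and \<open>r j\<close>, and normality equates their
  membership.\<close>

lemma spike_transfer:
  assumes F: "normal_filter kle K F" and j: "j \<in> J" and x: "x \<in> carrier A"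
  shows "Inr (spike (l j) x) \<in> F \<longleftrightarrow> Inr (spike (r j) x) \<in> F"
proof -
  let ?f = "\<lambda>k\<in>J. if k = j then x else \<one>"
  have push_spike: "push h u = spike (h j) x"
    if "inj_on h J" "h ` J \<subseteq> I" "\<And>k. k \<in> J \<Longrightarrow> u k = (if k = j then x else \<one>)" for h u
  proof (rule extensionalityI[of _ I])
    fix i assume "i \<in> I"
    then show "push h u i = spike (h j) x i"
      using that j by (cases "i \<in> h ` J") (auto simp: push_image push_outside spike_def inj_on_eq_iff)
  qed (simp_all add: spike_def)
  have "kite_rdiv A I J l r (kite_zero A J) (Inl ?f) = Inr (spike (l j) x)"
    using x by (auto simp: kite_zero_def intro!: push_spike l_inj l_image)
  moreover have "kite_ldiv A I J l r (Inl ?f) (kite_zero A J) = Inr (spike (r j) x)"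
    using x by (auto simp: kite_zero_def intro!: push_spike r_inj r_image)
  ultimately show ?thesis
    using kite_normal_filterD(5)[OF F, of "Inl ?f" "kite_zero A J"] x by simp
qed

section \<open>Orbits of the index maps\<close>

abbreviation fwd where "fwd \<equiv> partial_power (\<lambda>x. map_option r (partial_inv J l x))"
abbreviation bwd where "bwd \<equiv> partial_power (\<lambda>x. map_option l (partial_inv J r x))"

text \<open>Views the partial maps as steps along edges joining \<open>l j\<close> and
  \<open>r j\<close>, which avoids inverses in the inductions on walks.\<close>

lemma map_partial_inv_eq_Some:
  assumes "inj_on h J"
  shows "map_option h' (partial_inv J h x) = Some y \<longleftrightarrow> (\<exists>j\<in>J. x = h j \<and> y = h' j)"
  using assms by (auto simp: partial_inv_def the_inv_into_f_f)

lemma partial_power_Suc_eq_Some: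
  "partial_power p (Suc m) i = Some y \<longleftrightarrow> (\<exists>x. partial_power p m i = Some x \<and> p x = Some y)"
  by (auto simp: partial_power_def bind_eq_Some_conv)

lemma partial_power_0 [simp]: "partial_power p 0 i = Some i"
  by (simp add: partial_power_def)

lemma power_simps:
  "fwd 0 i = Some k \<longleftrightarrow> i = k" "bwd 0 i = Some k \<longleftrightarrow> i = k"
  "fwd (Suc m) i = Some k \<longleftrightarrow> (\<exists>j\<in>J. fwd m i = Some (l j) \<and> k = r j)"
  "bwd (Suc m) i = Some k \<longleftrightarrow> (\<exists>j\<in>J. bwd m i = Some (r j) \<and> k = l j)"
  by (auto simp: partial_power_Suc_eq_Some map_partial_inv_eq_Some l_inj r_inj
      simp del: map_option_eq_Some)

lemma spike_connected:
  assumes F: "normal_filter kle K F" and x: "x \<in> carrier A" "Inr (spike i x) \<in> F"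
  shows "fwd m i = Some k \<Longrightarrow> Inr (spike k x) \<in> F" "bwd m i = Some k \<Longrightarrow> Inr (spike k x) \<in> F"
  by (induction m arbitrary: k) (use x spike_transfer[OF F] in \<open>auto simp: power_simps\<close>)

definition component where "component i = {k. \<exists>m. fwd m i = Some k \<or> bwd m i = Some k}"

text \<open>Each index has at most one edge from \<open>l j\<close> to \<open>r j\<close> in either direction, so a step against the
  direction of a walk merely undoes its last step.\<close>

lemma component_edge:
  assumes "j \<in> J"
  shows "l j \<in> component i \<longleftrightarrow> r j \<in> component i"
proof
  assume "l j \<in> component i"
  then obtain m where "fwd m i = Some (l j) \<or> bwd m i = Some (l j)"
    by (auto simp: component_def)
  \<comment> \<open>The middle alternative covers the empty backward walk, where
    \<open>i = l j\<close> and there is no last step to drop.\<close>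
  then have "fwd (Suc m) i = Some (r j) \<or> fwd (Suc 0) i = Some (r j) \<or> bwd (m - 1) i = Some (r j)"
    using assms by (cases m) (auto simp: power_simps inj_on_eq_iff[OF l_inj])
  then show "r j \<in> component i" by (auto simp: component_def)
next
  assume "r j \<in> component i"
  then obtain m where "fwd m i = Some (r j) \<or> bwd m i = Some (r j)"
    by (auto simp: component_def)
  then have "bwd (Suc m) i = Some (l j) \<or> bwd (Suc 0) i = Some (l j) \<or> fwd (m - 1) i = Some (l j)"
    using assms by (cases m) (auto simp: power_simps inj_on_eq_iff[OF r_inj])
  then show "l j \<in> component i" by (auto simp: component_def)
qed

lemma connecting_maps_iff: "connecting_maps I J l r \<longleftrightarrow> (\<forall>i\<in>I. I \<subseteq> component i)"
  by (auto simp: connecting_maps_def component_def)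

text \<open>Applied both to an orbit and to its complement, which are each invariant under the
  edges.\<close>

lemma component_normal_filter:
  assumes "\<And>j. j \<in> J \<Longrightarrow> l j \<in> C \<longleftrightarrow> r j \<in> C"
  shows "normal_filter kle K (supported (carrier A) (Pow C))"
  by (rule supported_normal_filter[OF carrier_normal_filter]) (use assms in blast)+

text \<open>Such a family is the finite product of its spikes, built up by induction over the
  support.\<close>

lemma finite_family_in_filter:
  assumes F: "normal_filter kle K F" and a: "Inr a \<in> kite_carrier A I J"
    and fin: "finite {i\<in>I. a i \<noteq> \<one>}" and spikes: "\<And>i. i \<in> I \<Longrightarrow> Inr (spike i (a i)) \<in> F"
  shows "Inr a \<in> F"
proof -
  have "Inr (\<lambda>i\<in>I. if i \<in> T then a i else \<one>) \<in> F" if "finite T" "T \<subseteq> I" for T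
    using that
  proof (induction T)
    case empty
    then show ?case using kite_normal_filterD(2)[OF F] by (simp add: kite_one_def restrict_def)
  next
    case (insert t T)
    let ?b = "Inr (\<lambda>i\<in>I. if i \<in> T then a i else \<one>) :: ('a, 'i, 'j) kite_elem"
    have "?b \<in> F" by (rule insert.IH) (use insert.prems in auto)
    then have "kite_mult A I J l r ?b (Inr (spike t (a t))) \<in> F"
      using insert.prems by (intro kite_normal_filterD(3)[OF F] spikes) simp_all
    \<comment> \<open>At \<open>t\<close> the partial product is still \<open>\<one>\<close>,
      because \<open>t\<close> is not in \<open>T\<close>.\<close>
    also have "kite_mult A I J l r ?b (Inr (spike t (a t)))
      = Inr (\<lambda>i\<in>I. if i \<in> insert t T then a i else \<one>)"
      using a insert.hyps by (auto simp: spike_def intro!: restrict_ext)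
    finally show ?case .
  qed
  from this[OF fin] have "Inr (\<lambda>i\<in>I. if i \<in> {i\<in>I. a i \<noteq> \<one>} then a i else \<one>) \<in> F" by blast
  also have "(\<lambda>i\<in>I. if i \<in> {i\<in>I. a i \<noteq> \<one>} then a i else \<one>) = a"
    using a by (auto intro!: extensionalityI[of _ I])
  finally show ?thesis .
qed

text \<open>Replacing all other entries by the top element only moves the family upwards.\<close>

lemma spike_of_member:
  assumes F: "normal_filter kle K F" and a: "Inr a \<in> F" and i: "i \<in> I"
  shows "Inr (spike i (a i)) \<in> F"
proof -
  have "Inr a \<in> kite_carrier A I J" using kite_normal_filterD(1)[OF F] a by blast
  then show ?thesis
    using i by (intro kite_normal_filterD(4)[OF F a]) (auto simp: spike_def)
qed

section \<open>Subdirect irreducibility of the kite\<close>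

lemma spike_eq_one: "i \<in> I \<Longrightarrow> (Inr (spike i x) :: ('a, 'i, 'j) kite_elem) = kite_one A I \<longleftrightarrow> x = \<one>"
  by (auto simp: spike_def kite_one_def fun_eq_iff restrict_def)

lemma nontrivial_family:
  assumes "Inr a \<in> kite_carrier A I J" "(Inr a :: ('a, 'i, 'j) kite_elem) \<noteq> kite_one A I"
  obtains i where "i \<in> I" "a i \<noteq> \<one>"
  using assms by (force simp: kite_one_def intro: extensionalityI[of _ I])

lemma kite_subdirectly_irreducible:
  assumes si: "subdirectly_irreducible (hoop_le A) A" and conn: "connecting_maps I J l r"
    and nontriv: "carrier A \<noteq> {\<one>}" and "I \<noteq> {}"
  shows "subdirectly_irreducible kle K"
proof -
  have "\<nexists>x. carrier A = {x}" using nontriv one_closed by (metis singletonD)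
  then obtain N where N: "normal_filter (hoop_le A) A N" and "N \<noteq> {\<one>}"
    and least: "\<And>F. \<lbrakk>normal_filter (hoop_le A) A F; F \<noteq> {\<one>}\<rbrakk> \<Longrightarrow> N \<subseteq> F"
    using si unfolding subdirectly_irreducible_def by auto
  obtain i n where i: "i \<in> I" and n: "n \<in> N" "n \<noteq> \<one>"
    using \<open>N \<noteq> {\<one>}\<close> \<open>I \<noteq> {}\<close> normal_filterD(2)[OF N] by blast
  define M where "M = supported N {T. finite T}"
  \<comment> \<open>Injectivity makes finiteness of a support invariant under both
    transports.\<close>
  have "finite (l ` T) \<longleftrightarrow> finite (r ` T)" if "T \<subseteq> J" for T
    using that l_inj r_inj by (metis finite_image_iff inj_on_subset)
  then have M: "normal_filter kle K M"
    unfolding M_def by (intro supported_normal_filter[OF N]) (auto intro: finite_subset)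
  have "Inr (spike i n) \<in> M"
    using n normal_filterD(2)[OF N]
    by (auto simp: M_def spike_def intro: finite_subset[of _ "{i}"])
  then have "M \<noteq> {kite_one A I}"
    using spike_eq_one[OF i, of n] n by auto
  moreover have "M \<subseteq> F" if F: "normal_filter kle K F" and "F \<noteq> {kite_one A I}" for F
  proof -
    note FD = kite_normal_filterD[OF F]
    obtain y where y: "y \<in> F" "y \<noteq> kite_one A I"
      using \<open>F \<noteq> {kite_one A I}\<close> FD(2) by blast
    then have "y \<in> kite_carrier A I J" using FD(1) by blast
    then show ?thesis
    proof (cases y rule: kite_cases)
      \<comment> \<open>The square of a barred family is the bottom, so \<open>F\<close> is the
        whole kite.\<close>
      case (Inl f)
      then have "kite_zero A J \<in> F" using FD(3)[OF y(1) y(1)] by simp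
      then have "kite_carrier A I J \<subseteq> F" using FD(4) by auto
      then show ?thesis using kite_normal_filterD(1)[OF M] by blast
    next
      case (Inr a)
      then obtain p where p: "p \<in> I" "a p \<noteq> \<one>"
        using nontrivial_family y FD(1) by blast
      have "Inr (spike p (a p)) \<in> F"
        using spike_of_member[OF F _ p(1)] y Inr by simp
      \<comment> \<open>The entries of spikes at \<open>p\<close> form a normal filter of
        \<open>A\<close> containing \<open>a p\<close>, so leastness of \<open>N\<close> applies;
        connectedness then spreads these spikes to every index.\<close>
      then have N_p: "N \<subseteq> {x \<in> carrier A. Inr (spike p x) \<in> F}"
        using p Inr by (intro least spike_normal_filter[OF F]) auto
      have spikes: "Inr (spike k x) \<in> F" if "k \<in> I" "x \<in> N" for k x
      proof -
        have "k \<in> component p" using conn p that by (auto simp: connecting_maps_iff)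
        then show ?thesis
          using spike_connected[OF F, of x p _ k] N_p that by (auto simp: component_def)
      qed
      show ?thesis
      proof
        fix z assume z: "z \<in> M"
        then obtain b where b: "z = Inr b" by (auto simp: M_def supported_def)
        show "z \<in> F"
          unfolding b
        proof (rule finite_family_in_filter[OF F])
          show "Inr b \<in> kite_carrier A I J" using z kite_normal_filterD(1)[OF M] b by blast
          show "Inr (spike k (b k)) \<in> F" if "k \<in> I" for k
            using z that by (intro spikes) (auto simp: b M_def)
        qed (use z in \<open>simp add: b M_def\<close>)
      qed
    qed
  qed
  ultimately show ?thesis
    unfolding subdirectly_irreducible_def kite_sel using M by blast
qed

lemma kite_subdirectly_irreducibleD:
  assumes si: "subdirectly_irreducible kle K" and nontriv: "carrier A \<noteq> {\<one>}" and "I \<noteq> {}"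
  shows "subdirectly_irreducible (hoop_le A) A" "connecting_maps I J l r"
proof -
  have "kite_one A I \<noteq> (kite_zero A J :: ('a, 'i, 'j) kite_elem)"
    by (simp add: kite_one_def kite_zero_def)
  then have "\<nexists>x. kite_carrier A I J = {x}"
    using kite_one_closed kite_zero_closed by (metis singletonD)
  then obtain M where M: "normal_filter kle K M" and "M \<noteq> {kite_one A I}"
    and least: "\<And>F. \<lbrakk>normal_filter kle K F; F \<noteq> {kite_one A I}\<rbrakk> \<Longrightarrow> M \<subseteq> F"
    using si unfolding subdirectly_irreducible_def by auto
  note MD = kite_normal_filterD[OF M]
  obtain x where x: "x \<in> carrier A" "x \<noteq> \<one>" using nontriv one_closed by blast
  obtain y where y: "y \<in> M" "y \<noteq> kite_one A I" using \<open>M \<noteq> {kite_one A I}\<close> MD(2) by blast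
  have nontriv_supp: "supported N S \<noteq> {kite_one A I}"
    if "i \<in> I" "x \<in> N" "x \<noteq> \<one>" "\<one> \<in> N" "{i} \<in> S" for N S i x
  proof -
    have "{k \<in> I. spike i x k \<noteq> \<one>} = {i}"
      using that by (auto simp: spike_def)
    then have "Inr (spike i x) \<in> supported N S"
      using that by (simp add: spike_def)
    then show ?thesis using spike_eq_one[OF that(1), of x] that by auto
  qed
  \<comment> \<open>The spike of a non-unit at \<open>i\<close> makes this filter non-trivial, so it
    contains \<open>M\<close>.\<close>
  have in_comp: "M \<subseteq> supported (carrier A) (Pow C)"
    if "\<And>j. j \<in> J \<Longrightarrow> l j \<in> C \<longleftrightarrow> r j \<in> C" "i \<in> I" "i \<in> C" for C i
    using that x by (intro least component_normal_filter nontriv_supp[of i x]) auto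
  obtain i where "i \<in> I" using \<open>I \<noteq> {}\<close> by blast
  \<comment> \<open>Taking \<open>C = UNIV\<close> shows that \<open>M\<close> contains no barred
    family.\<close>
  have "M \<subseteq> supported (carrier A) (Pow UNIV)"
    using \<open>i \<in> I\<close> by (intro in_comp) auto
  then obtain a where a: "y = Inr a" "Inr a \<in> kite_carrier A I J"
    using y MD(1) by (auto simp: supported_def)
  obtain p where p: "p \<in> I" "a p \<noteq> \<one>"
    using nontrivial_family a y by blast

  show "connecting_maps I J l r"
    unfolding connecting_maps_iff
  proof (intro ballI subsetI, rule ccontr)
    fix i k assume ik: "i \<in> I" "k \<in> I" "k \<notin> component i"
    have "i \<in> component i" by (auto simp: component_def power_simps intro!: exI[of _ 0])
    then have "M \<subseteq> supported (carrier A) (Pow (component i))"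
      using ik component_edge by (intro in_comp[of _ i]) auto
    \<comment> \<open>The unreachable index \<open>k\<close> witnesses that the complement also
      carries a non-trivial filter. The entry \<open>a p\<close> would then force \<open>p\<close>
      into both sets.\<close>
    moreover have "M \<subseteq> supported (carrier A) (Pow (- component i))"
      using ik component_edge by (intro in_comp[of _ k]) auto
    ultimately have "Inr a \<in> supported (carrier A) (Pow (component i))"
      "Inr a \<in> supported (carrier A) (Pow (- component i))"
      using y(1) unfolding a(1) by blast+
    then show False using p by auto
  qed

  \<comment> \<open>The trace of \<open>M\<close> at an index where some member is not
    \<open>\<one>\<close> is the candidate for the least normal filter of \<open>A\<close>.\<close>
  define N where "N = {x \<in> carrier A. Inr (spike p x) \<in> M}"
  have N: "normal_filter (hoop_le A) A N"
    unfolding N_def by (rule spike_normal_filter[OF M p(1)])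
  have "a p \<in> N"
    using spike_of_member[OF M _ p(1)] y a p by (auto simp: N_def)
  then have "N \<noteq> {\<one>}" using p by auto
  moreover have "N \<subseteq> F" if F: "normal_filter (hoop_le A) A F" and "F \<noteq> {\<one>}" for F
  proof -
    obtain x where "x \<in> F" "x \<noteq> \<one>" using \<open>F \<noteq> {\<one>}\<close> normal_filterD(2)[OF F] by blast
    \<comment> \<open>All families with values in \<open>F\<close> form a non-trivial normal filter
      and hence include \<open>M\<close>; reading the coordinate \<open>p\<close> gives the
      inclusion of \<open>N\<close> in \<open>F\<close>.\<close>
    then have "M \<subseteq> supported F (Pow UNIV)"
      using normal_filterD(2)[OF F] p
      by (intro least supported_normal_filter[OF F] nontriv_supp[of p x]) auto
    then have "Inr (spike p x) \<in> supported F (Pow UNIV)" if "x \<in> N" for x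
      using that by (auto simp: N_def)
    then show ?thesis using p by (force simp: spike_def)
  qed
  ultimately show "subdirectly_irreducible (hoop_le A) A"
    unfolding subdirectly_irreducible_def using N by blast
qed

end

text \<open>The conjuncts separate subdirect irreducibility of the kite from the pseudo BL axioms,
  which hold exactly when \<open>J\<close> is empty or \<open>A\<close> is cancellative. The
  condition on \<open>I\<close> excludes the two-element kite, which is subdirectly irreducible
  whatever \<open>A\<close> is.\<close>

theorem theorem4p3:
  fixes A :: "('a, 'm) residuated_scheme"
    and I :: "'i set" and J :: "'j set" and l r :: "'j \<Rightarrow> 'i"
  assumes "basic_pseudo_hoop A"
    and "carrier A \<noteq> {\<one>\<^bsub>A\<^esub>}"
    and "I \<noteq> {}"
    and "J \<lesssim> I"
    and "l ` J \<subseteq> I" and "inj_on l J"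
    and "r ` J \<subseteq> I" and "inj_on r J"
  shows "(subdirectly_irreducible (hoop_le A) A \<and> connecting_maps I J l r \<longleftrightarrow>
          subdirectly_irreducible (kite_le A I J) (kite A I J l r)) \<and>
         (J = {} \<or> cancellative A \<longrightarrow>
          (subdirectly_irreducible (hoop_le A) A \<and> connecting_maps I J l r \<longleftrightarrow>
           pseudo_BL_algebra (kite A I J l r) \<and>
           subdirectly_irreducible (kite_le A I J) (kite A I J l r))) \<and>
         (pseudo_BL_algebra (kite A I J l r) \<longrightarrow> J = {} \<or> cancellative A)"
proof -
  interpret basic_pseudo_hoop A by fact
  interpret basic_pseudo_hoop_kite A I J l r
    by unfold_locales fact+
  have si: "subdirectly_irreducible (hoop_le A) A \<and> connecting_maps I J l r
    \<longleftrightarrow> subdirectly_irreducible kle K"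
    using kite_subdirectly_irreducible[OF _ _ assms(2,3)]
      kite_subdirectly_irreducibleD[OF _ assms(2,3)] by (intro iffI conjI) simp_all
  have "J = {} \<or> cancellative A \<longleftrightarrow> pseudo_BL_algebra K"
    using kite_pseudo_BL pseudo_BL_kite_imp_cancellative by auto
  then show ?thesis
    unfolding si by simp
qed

end
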